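(* A bounded operator $T$ on $H^2(\mathbb G)^\perp=L^2(b\Gamma)\ominus H^2(\mathbb G)$ is a dual Toeplitz operator (i.e. $T=DT_\varphi$ for some $\varphi\in L^\infty(b\Gamma)$) if and only if it satisfies the Brown-Halmos relations with respect to $(DT_{\overline s},DT_{\overline p})$, that is, $$DT_{\overline s}^{\,*}\,T\,DT_{\overline p}=T\,DT_{\overline s}\quad\text{and}\quad DT_{\overline p}^{\,*}\,T\,DT_{\overline p}=T.$$
   Context: $\mathbb D$ is the open unit disc, $\mathbb T$ the unit circle, $m$ the product of normalized arc length measures on $\mathbb T^2=\mathbb T\times\mathbb T$. Let $\pi(z_1,z_2)=(z_1+z_2,z_1z_2)$, $J(z_1,z_2)=z_1-z_2$, $\|J\|^2=\int_{\mathbb T^2}|J|^2dm=2$, $\mathbb G=\pi(\mathbb D^2)$ and $b\Gamma=\pi(\mathbb T^2)$, with coordinates denoted $(s,p)$. Let $\nu$ be the Borel measure on $b\Gamma$ given by $\nu(E)=\int_{\pi^{-1}(E)}|J|^2dm$. $L^2(b\Gamma)$ is the Hilbert space of ($\nu$-a.e. classes of) functions on $b\Gamma$ with $\int|f|^2d\nu<\infty$, with norm $\|f\|^2=\|J\|^{-2}\int_{b\Gamma}|f|^2d\nu$; $L^\infty(b\Gamma)$ is the space of essentially bounded functions. $L^2_{\rm anti}(\mathbb T^2)=\{f\in L^2(\mathbb T^2):f(\zeta_1,\zeta_2)=-f(\zeta_2,\zeta_1)\text{ a.e.}\}$, and $U:L^2(b\Gamma)\to L^2_{\rm anti}(\mathbb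 T^2)$ is the unitary $Uf=\frac1{\|J\|}J\,(f\circ\pi)$. $H^2(\mathbb G)$ is the Hilbert space of holomorphic $f$ on $\mathbb G$ with $\|f\|=\|J\|^{-1}\{\sup_{0<r<1}\int_{\mathbb T^2}|f\circ\pi(r\zeta)|^2|J(r\zeta)|^2dm(\zeta)\}^{1/2}<\infty$; via boundary values it is identified with the closed subspace of those $f\in L^2(b\Gamma)$ for which $Uf$ has Fourier coefficients supported on $\{(i,j):i,j\ge0\}$. $Pr$ is the orthogonal projection of $L^2(b\Gamma)$ onto $H^2(\mathbb G)$. For $\varphi\in L^\infty(b\Gamma)$, $M_\varphi$ is multiplication by $\varphi$ on $L^2(b\Gamma)$, and the dual Toeplitz operator $DT_\varphi$ on $H^2(\mathbb G)^\perp$ is $DT_\varphi=(I-Pr)M_\varphi|_{H^2(\mathbb G)^\perp}$. $\overline s,\overline p$ are the complex conjugates of the coordinate functions. *)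

theory Defs
  imports "HOL-Analysis.Analysis"
begin

section \<open>The measures on the torus and on the distinguished boundary\<close>

definition circle :: "complex set" where
  "circle = sphere 0 1"

definition arc_measure :: "complex measure" where
  "arc_measure = distr (uniform_measure lborel {0..2 * pi}) (restrict_space borel circle) cis"

definition torus_measure :: "(complex \<times> complex) measure" where
  "torus_measure = arc_measure \<Otimes>\<^sub>M arc_measure"

definition symm_map :: "complex \<times> complex \<Rightarrow> complex \<times> complex" where
  "symm_map = (\<lambda>(z1, z2). (z1 + z2, z1 * z2))"

definition Jac :: "complex \<times> complex \<Rightarrow> complex" where
  "Jac = (\<lambda>(z1, z2). z1 - z2)"

definition Jac_norm :: real where
  "Jac_norm = sqrt (LINT z|torus_measure. (cmod (Jac z))\<^sup>2)"

definition bGamma :: "(complex \<times> complex) set" where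
  "bGamma = symm_map ` (circle \<times> circle)"

definition nu :: "(complex \<times> complex) measure" where
  "nu = distr (density torus_measure (\<lambda>z. ennreal ((cmod (Jac z))\<^sup>2)))
          (restrict_space borel bGamma) symm_map"

lemma space_arc [simp]: "space arc_measure = circle"
  and sets_arc: "sets arc_measure = sets (restrict_space borel circle)"
  by (auto simp: arc_measure_def space_restrict_space)

lemma cis_measurable_circle: "cis \<in> measurable (uniform_measure lborel {0..2 * pi}) (restrict_space borel circle)"
proof -
  have "cis \<in> borel_measurable borel"
    by (intro borel_measurable_continuous_onI continuous_intros)
  then show ?thesis
    by (intro measurable_restrict_space2) (auto simp: circle_def)
qed

lemma emeasure_arc_space: "emeasure arc_measure circle = 1"
proof -
  have "circle = space (restrict_space borel circle)"
    by (simp add: space_restrict_space)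
  then have "circle \<in> sets (restrict_space borel circle)"
    by (metis sets.top)
  then have "emeasure arc_measure circle
      = emeasure (uniform_measure lborel {0..2 * pi}) (cis -` circle \<inter> UNIV)"
    unfolding arc_measure_def
    by (subst emeasure_distr[OF cis_measurable_circle]) (auto simp: uniform_measure_def)
  also have "cis -` circle \<inter> UNIV = UNIV"
    by (auto simp: circle_def)
  also have "emeasure (uniform_measure lborel {0..2 * pi}) UNIV = 1"
    by (subst emeasure_uniform_measure) (auto simp: ennreal_divide_self)
  finally show ?thesis .
qed

lemma finite_measure_arc: "finite_measure arc_measure"
  by (rule finite_measureI) (simp add: emeasure_arc_space)

lemma pair_sigma_finite_arc: "pair_sigma_finite arc_measure arc_measure"
  using finite_measure_arc by (simp add: pair_sigma_finite_def finite_measure_def)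

lemma space_torus: "space torus_measure = circle \<times> circle"
  by (simp add: torus_measure_def space_pair_measure)

lemma emeasure_torus_space: "emeasure torus_measure (space torus_measure) = 1"
proof -
  interpret finite_measure arc_measure by (rule finite_measure_arc)
  have "circle \<in> sets arc_measure"
    by (metis sets.top space_arc)
  then show ?thesis
    by (simp add: torus_measure_def space_pair_measure emeasure_pair_measure_Times
        emeasure_arc_space)
qed

lemma finite_measure_torus: "finite_measure torus_measure"
  by (rule finite_measureI) (simp add: emeasure_torus_space)

lemma arc_id_borel: "(\<lambda>x. x) \<in> borel_measurable arc_measure"
proof -
  have "(\<lambda>x. x) \<in> borel_measurable (restrict_space borel circle)"
    by (intro measurable_restrict_space1) simp
  then show ?thesis
    using measurable_cong_sets[OF sets_arc refl] by auto
qed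

lemma torus_fst [measurable]: "fst \<in> borel_measurable torus_measure"
  unfolding torus_measure_def
  using measurable_comp[OF measurable_fst arc_id_borel] by (simp add: comp_def)

lemma torus_snd [measurable]: "snd \<in> borel_measurable torus_measure"
  unfolding torus_measure_def
  using measurable_comp[OF measurable_snd arc_id_borel] by (simp add: comp_def)

lemma Jac_measurable [measurable]: "Jac \<in> borel_measurable torus_measure"
  unfolding Jac_def case_prod_beta by measurable

lemma symm_map_measurable [measurable]:
  "symm_map \<in> measurable torus_measure (restrict_space borel bGamma)"
proof -
  have "symm_map \<in> borel_measurable torus_measure"
    unfolding symm_map_def case_prod_beta by measurable
  then show ?thesis
    by (intro measurable_restrict_space2) (auto simp: space_torus bGamma_def)
qed

lemma space_nu: "space nu = bGamma"
  and sets_nu: "sets nu = sets (restrict_space borel bGamma)"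
  by (auto simp: nu_def space_restrict_space)

lemma emeasure_nu:
  assumes "E \<in> sets nu"
  shows "emeasure nu E
    = (\<integral>\<^sup>+ z\<in>symm_map -` E \<inter> space torus_measure. ennreal ((cmod (Jac z))\<^sup>2) \<partial>torus_measure)"
proof -
  have E: "E \<in> sets (restrict_space borel bGamma)"
    using assms by (simp add: sets_nu)
  have "symm_map -` E \<inter> space torus_measure \<in> sets torus_measure"
    by (rule measurable_sets[OF symm_map_measurable E])
  then show ?thesis
    unfolding nu_def using E
    by (subst emeasure_distr) (simp_all add: emeasure_density)
qed

lemma integral_arc_Jac:
  assumes "z \<in> circle"
  shows "(LINT w|arc_measure. (cmod (Jac (z, w)))\<^sup>2) = 2"
proof -
  define g where "g t = 2 - 2 * (Re z * cos t + Im z * sin t)" for t :: real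
  have z: "(Re z)\<^sup>2 + (Im z)\<^sup>2 = 1"
    using assms by (simp add: circle_def cmod_def)
  have gt: "(cmod (z - cis t))\<^sup>2 = g t" for t
  proof -
    have "(cmod (z - cis t))\<^sup>2
        = ((Re z)\<^sup>2 + (Im z)\<^sup>2) + ((cos t)\<^sup>2 + (sin t)\<^sup>2) - 2 * (Re z * cos t + Im z * sin t)"
      by (simp only: cmod_power2) (simp add: power2_eq_square algebra_simps)
    then show ?thesis
      by (simp only: z g_def) simp
  qed
  have cont: "continuous_on UNIV g"
    unfolding g_def by (intro continuous_intros)
  then have gm [measurable]: "g \<in> borel_measurable borel"
    by (rule borel_measurable_continuous_onI)
  have "(LINT w|arc_measure. (cmod (Jac (z, w)))\<^sup>2)
      = (LINT t|uniform_measure lborel {0..2 * pi}. (cmod (z - cis t))\<^sup>2)"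
    unfolding arc_measure_def Jac_def prod.case
    by (rule integral_distr[OF cis_measurable_circle])
      (intro measurable_restrict_space1, measurable)
  also have "\<dots> = (LINT t|density lborel (\<lambda>t. ennreal (indicator {0..2 * pi} t / (2 * pi))). g t)"
    unfolding gt uniform_measure_def
    by (intro arg_cong2[where f = "integral\<^sup>L"] density_cong refl)
      (auto simp: indicator_def divide_ennreal ennreal_1[symmetric] simp del: ennreal_1)
  also have "\<dots> = (LINT t|lborel. (indicator {0..2 * pi} t / (2 * pi)) *\<^sub>R g t)"
    by (rule integral_density) auto
  also have "\<dots> = (LINT t|lborel. (indicator {0..2 * pi} t *\<^sub>R g t) * (1 / (2 * pi)))"
    by (intro Bochner_Integration.integral_cong) auto
  also have "\<dots> = (LINT t|lborel. indicator {0..2 * pi} t *\<^sub>R g t) * (1 / (2 * pi))"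
    by simp
  also have "(LINT t|lborel. indicator {0..2 * pi} t *\<^sub>R g t)
      = (\<lambda>t. 2 * t - 2 * (Re z * sin t - Im z * cos t)) (2 * pi)
      - (\<lambda>t. 2 * t - 2 * (Re z * sin t - Im z * cos t)) 0"
  proof (rule integral_FTC_atLeastAtMost)
    show "((\<lambda>t. 2 * t - 2 * (Re z * sin t - Im z * cos t)) has_vector_derivative g t)
        (at t within {0..2 * pi})" for t
      unfolding g_def has_real_derivative_iff_has_vector_derivative[symmetric]
      by (auto intro!: derivative_eq_intros)
    show "continuous_on {0..2 * pi} g"
      using cont continuous_on_subset by blast
  qed simp
  finally show ?thesis by simp
qed

lemma Jac_bound: "z \<in> space torus_measure \<Longrightarrow> cmod (Jac z) \<le> 2"
  using norm_triangle_ineq4[of "fst z" "snd z"]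
  by (auto simp: space_torus circle_def Jac_def split: prod.splits)

lemma integrable_Jac: "integrable torus_measure (\<lambda>z. (cmod (Jac z))\<^sup>2)"
proof (rule finite_measure.integrable_const_bound[OF finite_measure_torus, where B = 4])
  show "AE z in torus_measure. norm ((cmod (Jac z))\<^sup>2) \<le> 4"
  proof (rule AE_I2)
    fix z assume "z \<in> space torus_measure"
    from power_mono[OF Jac_bound[OF this] norm_ge_zero, of 2]
    show "norm ((cmod (Jac z))\<^sup>2) \<le> 4" by simp
  qed
qed measurable

lemma Jac_norm_square: "Jac_norm\<^sup>2 = 2"
proof -
  interpret pair_sigma_finite arc_measure arc_measure by (rule pair_sigma_finite_arc)
  have "(LINT z|torus_measure. (cmod (Jac z))\<^sup>2)
      = (LINT z|arc_measure. LINT w|arc_measure. (cmod (Jac (z, w)))\<^sup>2)"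
    using integrable_Jac unfolding torus_measure_def by (rule integral_fst'[symmetric])
  also have "\<dots> = (LINT z|arc_measure. 2)"
    by (intro Bochner_Integration.integral_cong) (auto simp: integral_arc_Jac)
  also have "\<dots> = 2"
    by (simp add: measure_def emeasure_arc_space)
  finally show ?thesis by (simp add: Jac_norm_def)
qed

lemma Jac_norm_pos: "Jac_norm > 0"
  using Jac_norm_square by (auto simp: Jac_norm_def intro: ccontr)

section \<open>The Hilbert space of square integrable functions on the boundary\<close>

definition sq_int :: "(complex \<times> complex \<Rightarrow> complex) \<Rightarrow> bool" where
  "sq_int f \<longleftrightarrow> f \<in> borel_measurable nu \<and> integrable nu (\<lambda>x. (cmod (f x))\<^sup>2)"

definition L2_rel :: "(complex \<times> complex \<Rightarrow> complex) \<Rightarrow> (complex \<times> complex \<Rightarrow> complex) \<Rightarrow> bool" where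
  "L2_rel f g \<longleftrightarrow> sq_int f \<and> sq_int g \<and> (AE x in nu. f x = g x)"

lemma cnj_measurable [measurable (raw)]:
  assumes "f \<in> borel_measurable M"
  shows "(\<lambda>x. cnj (f x)) \<in> borel_measurable M"
  by (rule measurable_compose[OF assms borel_measurable_continuous_onI]) (intro continuous_intros)

lemma sq_int_zero: "sq_int (\<lambda>_. 0)"
  by (simp add: sq_int_def)

lemma sq_int_bounded_mult:
  assumes f: "sq_int f" and m: "h \<in> borel_measurable nu" and b: "AE x in nu. cmod (h x) \<le> C"
  shows "sq_int (\<lambda>x. h x * f x)"
proof -
  have [measurable]: "f \<in> borel_measurable nu" "h \<in> borel_measurable nu"
    using f m by (auto simp: sq_int_def)
  have "integrable nu (\<lambda>x. (cmod (h x * f x))\<^sup>2)"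
  proof (rule Bochner_Integration.integrable_bound)
    show "integrable nu (\<lambda>x. C\<^sup>2 * (cmod (f x))\<^sup>2)"
      using f by (simp add: sq_int_def)
    show "AE x in nu. norm ((cmod (h x * f x))\<^sup>2) \<le> norm (C\<^sup>2 * (cmod (f x))\<^sup>2)"
      using b by eventually_elim (auto simp: norm_mult power_mult_distrib intro!: mult_right_mono power_mono)
  qed measurable
  then show ?thesis by (simp add: sq_int_def)
qed

lemma sq_int_cmult: "sq_int f \<Longrightarrow> sq_int (\<lambda>x. c * f x)"
  by (rule sq_int_bounded_mult[where C = "cmod c"]) auto

lemma sq_int_add:
  assumes "sq_int f" "sq_int g"
  shows "sq_int (\<lambda>x. f x + g x)"
proof -
  have [measurable]: "f \<in> borel_measurable nu" "g \<in> borel_measurable nu"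
    using assms by (auto simp: sq_int_def)
  have ineq: "(cmod (a + b))\<^sup>2 \<le> 2 * (cmod a)\<^sup>2 + 2 * (cmod b)\<^sup>2" for a b
  proof -
    have "(cmod (a + b))\<^sup>2 \<le> (cmod a + cmod b)\<^sup>2"
      by (intro power_mono norm_triangle_ineq) auto
    also have "\<dots> \<le> 2 * (cmod a)\<^sup>2 + 2 * (cmod b)\<^sup>2"
      using zero_le_power2[of "cmod a - cmod b"] by (simp add: power2_sum power2_diff)
    finally show ?thesis .
  qed
  have "integrable nu (\<lambda>x. (cmod (f x + g x))\<^sup>2)"
  proof (rule Bochner_Integration.integrable_bound)
    show "integrable nu (\<lambda>x. 2 * (cmod (f x))\<^sup>2 + 2 * (cmod (g x))\<^sup>2)"
      using assms by (simp add: sq_int_def)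
    show "AE x in nu. norm ((cmod (f x + g x))\<^sup>2) \<le> norm (2 * (cmod (f x))\<^sup>2 + 2 * (cmod (g x))\<^sup>2)"
      by (intro AE_I2) (use ineq in auto)
  qed measurable
  then show ?thesis by (simp add: sq_int_def)
qed

lemma sq_int_minus: "sq_int f \<Longrightarrow> sq_int (\<lambda>x. - f x)"
  using sq_int_cmult[of f "- 1"] by simp

lemma sq_int_diff: "sq_int f \<Longrightarrow> sq_int g \<Longrightarrow> sq_int (\<lambda>x. f x - g x)"
  using sq_int_add[of f "\<lambda>x. - g x"] sq_int_minus[of g] by simp

lemma sq_int_prod_integrable:
  assumes "sq_int f" "sq_int g"
  shows "integrable nu (\<lambda>x. f x * cnj (g x))"
proof (rule Bochner_Integration.integrable_bound)
  have [measurable]: "f \<in> borel_measurable nu" "g \<in> borel_measurable nu"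
    using assms by (auto simp: sq_int_def)
  show "integrable nu (\<lambda>x. (cmod (f x))\<^sup>2 + (cmod (g x))\<^sup>2)"
    using assms by (simp add: sq_int_def)
  show "(\<lambda>x. f x * cnj (g x)) \<in> borel_measurable nu" by measurable
  have "a * b \<le> a\<^sup>2 + b\<^sup>2" if "a \<ge> 0" "b \<ge> 0" for a b :: real
  proof -
    have "2 * (a * b) \<le> a\<^sup>2 + b\<^sup>2"
      using zero_le_power2[of "a - b"] by (simp add: power2_diff)
    moreover have "0 \<le> a * b" using that by simp
    ultimately show ?thesis by linarith
  qed
  then show "AE x in nu. norm (f x * cnj (g x)) \<le> norm ((cmod (f x))\<^sup>2 + (cmod (g x))\<^sup>2)"
    by (intro AE_I2) (simp add: norm_mult)
qed

quotient_type L2_bGamma = "complex \<times> complex \<Rightarrow> complex" / partial: L2_rel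
proof (rule part_equivpI)
  show "\<exists>f. L2_rel f f"
    using sq_int_zero by (auto simp: L2_rel_def)
  show "symp L2_rel"
    by (rule sympI) (auto simp: L2_rel_def eq_commute)
  show "transp L2_rel"
    by (rule transpI) (auto simp: L2_rel_def elim: eventually_elim2)
qed

lift_definition cscale :: "complex \<Rightarrow> L2_bGamma \<Rightarrow> L2_bGamma" (infixr "*\<^sub>C" 75)
  is "\<lambda>c f x. c * f x"
  by (auto simp: L2_rel_def sq_int_cmult)

lift_definition cinner :: "L2_bGamma \<Rightarrow> L2_bGamma \<Rightarrow> complex"
  is "\<lambda>f g. (LINT x|nu. f x * cnj (g x)) / complex_of_real (Jac_norm\<^sup>2)"
proof -
  fix f f' g g' assume 1: "L2_rel f f'" and 2: "L2_rel g g'"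
  then have [measurable]: "f \<in> borel_measurable nu" "f' \<in> borel_measurable nu"
      "g \<in> borel_measurable nu" "g' \<in> borel_measurable nu"
    by (auto simp: L2_rel_def sq_int_def)
  have "AE x in nu. f x = f' x" "AE x in nu. g x = g' x"
    using 1 2 by (auto simp: L2_rel_def)
  then have "AE x in nu. f x * cnj (g x) = f' x * cnj (g' x)"
    by eventually_elim simp
  then have "(LINT x|nu. f x * cnj (g x)) = (LINT x|nu. f' x * cnj (g' x))"
    by (intro integral_cong_AE) measurable
  then show "(LINT x|nu. f x * cnj (g x)) / complex_of_real (Jac_norm\<^sup>2)
      = (LINT x|nu. f' x * cnj (g' x)) / complex_of_real (Jac_norm\<^sup>2)"
    by simp
qed

instantiation L2_bGamma :: real_vector
begin

lift_definition zero_L2_bGamma :: L2_bGamma is "\<lambda>_. 0"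
  by (simp add: L2_rel_def sq_int_zero)

lift_definition plus_L2_bGamma :: "L2_bGamma \<Rightarrow> L2_bGamma \<Rightarrow> L2_bGamma" is "\<lambda>f g x. f x + g x"
  by (auto simp: L2_rel_def sq_int_add elim: eventually_elim2)

lift_definition minus_L2_bGamma :: "L2_bGamma \<Rightarrow> L2_bGamma \<Rightarrow> L2_bGamma" is "\<lambda>f g x. f x - g x"
  by (auto simp: L2_rel_def sq_int_diff elim: eventually_elim2)

lift_definition uminus_L2_bGamma :: "L2_bGamma \<Rightarrow> L2_bGamma" is "\<lambda>f x. - f x"
  by (auto simp: L2_rel_def sq_int_minus)

definition scaleR_L2_bGamma :: "real \<Rightarrow> L2_bGamma \<Rightarrow> L2_bGamma" where
  "scaleR_L2_bGamma r f = complex_of_real r *\<^sub>C f"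

instance
proof
  fix f g h :: L2_bGamma and a b :: real
  show "f + g + h = f + (g + h)"
    by transfer (simp add: L2_rel_def sq_int_add add.assoc)
  show "f + g = g + f"
    by transfer (simp add: L2_rel_def sq_int_add add.commute)
  show "0 + f = f"
    by transfer (simp add: L2_rel_def)
  show "- f + f = 0"
    by transfer (simp add: L2_rel_def sq_int_zero)
  show "f - g = f + - g"
    by transfer (use sq_int_add sq_int_minus in \<open>auto simp: L2_rel_def intro!: sq_int_diff\<close>)
  show "a *\<^sub>R (f + g) = a *\<^sub>R f + a *\<^sub>R g"
    unfolding scaleR_L2_bGamma_def
    by transfer (use sq_int_add sq_int_cmult in \<open>simp add: L2_rel_def distrib_left\<close>)
  show "(a + b) *\<^sub>R f = a *\<^sub>R f + b *\<^sub>R f"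
    unfolding scaleR_L2_bGamma_def
    by transfer (use sq_int_add sq_int_cmult in \<open>simp add: L2_rel_def distrib_right\<close>)
  show "a *\<^sub>R b *\<^sub>R f = (a * b) *\<^sub>R f"
    unfolding scaleR_L2_bGamma_def
    by transfer (use sq_int_cmult in \<open>simp add: L2_rel_def mult.assoc\<close>)
  show "1 *\<^sub>R f = f"
    unfolding scaleR_L2_bGamma_def by transfer (simp add: L2_rel_def)
qed

end

text \<open>The library has no class of complex inner product spaces. The instance below supplies the
  norm, metric and topology; its \<open>inner\<close> is the real part of \<^const>\<open>cinner\<close>.\<close>

instantiation L2_bGamma :: real_inner
begin

lift_definition norm_L2_bGamma :: "L2_bGamma \<Rightarrow> real"
  is "\<lambda>f. sqrt (LINT x|nu. (cmod (f x))\<^sup>2) / Jac_norm"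
proof -
  fix f f' assume 1: "L2_rel f f'"
  then have [measurable]: "f \<in> borel_measurable nu" "f' \<in> borel_measurable nu"
    by (auto simp: L2_rel_def sq_int_def)
  have "AE x in nu. (cmod (f x))\<^sup>2 = (cmod (f' x))\<^sup>2"
    using 1 by (auto simp: L2_rel_def elim: eventually_mono)
  then have "(LINT x|nu. (cmod (f x))\<^sup>2) = (LINT x|nu. (cmod (f' x))\<^sup>2)"
    by (intro integral_cong_AE) measurable
  then show "sqrt (LINT x|nu. (cmod (f x))\<^sup>2) / Jac_norm = sqrt (LINT x|nu. (cmod (f' x))\<^sup>2) / Jac_norm"
    by simp
qed

definition inner_L2_bGamma :: "L2_bGamma \<Rightarrow> L2_bGamma \<Rightarrow> real" where
  "inner_L2_bGamma f g = Re (cinner f g)"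

definition sgn_L2_bGamma :: "L2_bGamma \<Rightarrow> L2_bGamma" where
  "sgn_L2_bGamma f = inverse (norm f) *\<^sub>R f"

definition dist_L2_bGamma :: "L2_bGamma \<Rightarrow> L2_bGamma \<Rightarrow> real" where
  "dist_L2_bGamma f g = norm (f - g)"

definition uniformity_L2_bGamma :: "(L2_bGamma \<times> L2_bGamma) filter" where
  "uniformity_L2_bGamma = (INF e\<in>{0<..}. principal {(x, y). dist x y < e})"

definition open_L2_bGamma :: "L2_bGamma set \<Rightarrow> bool" where
  "open_L2_bGamma U \<longleftrightarrow> (\<forall>x\<in>U. \<forall>\<^sub>F (x', y) in uniformity. x' = x \<longrightarrow> y \<in> U)"

lemma cinner_self: "cinner f f = complex_of_real ((norm f)\<^sup>2)"
proof transfer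
  fix f assume "L2_rel f f"
  have "(LINT x|nu. f x * cnj (f x)) = (LINT x|nu. complex_of_real ((cmod (f x))\<^sup>2))"
    by (simp only: complex_norm_square)
  then have "(LINT x|nu. f x * cnj (f x)) = complex_of_real (LINT x|nu. (cmod (f x))\<^sup>2)"
    by (simp only: integral_complex_of_real)
  moreover have "(LINT x|nu. (cmod (f x))\<^sup>2) \<ge> 0"
    by (intro Bochner_Integration.integral_nonneg) simp
  ultimately show "(LINT x|nu. f x * cnj (f x)) / complex_of_real (Jac_norm\<^sup>2)
      = complex_of_real ((sqrt (LINT x|nu. (cmod (f x))\<^sup>2) / Jac_norm)\<^sup>2)"
    by (simp add: power_divide flip: of_real_power)
qed

lemma norm_L2_eq_0: "norm (f :: L2_bGamma) = 0 \<longleftrightarrow> f = 0"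
proof (transfer, goal_cases)
  case (1 f)
  then have [measurable]: "f \<in> borel_measurable nu" and i: "integrable nu (\<lambda>x. (cmod (f x))\<^sup>2)"
    by (auto simp: L2_rel_def sq_int_def)
  have "sqrt (LINT x|nu. (cmod (f x))\<^sup>2) / Jac_norm = 0 \<longleftrightarrow> (LINT x|nu. (cmod (f x))\<^sup>2) = 0"
    using Jac_norm_pos by simp
  also have "\<dots> \<longleftrightarrow> (AE x in nu. (cmod (f x))\<^sup>2 = 0)"
    by (rule integral_nonneg_eq_0_iff_AE[OF i]) simp
  also have "\<dots> \<longleftrightarrow> L2_rel f (\<lambda>_. 0)"
    using 1 by (simp add: L2_rel_def sq_int_zero)
  finally show ?case .
qed

lemma norm_L2_nonneg: "norm (f :: L2_bGamma) \<ge> 0"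
  by transfer (use Jac_norm_pos in \<open>auto intro!: divide_nonneg_nonneg Bochner_Integration.integral_nonneg\<close>)

lemma cinner_add_left: "cinner (f + g) h = cinner f h + cinner g h"
proof (transfer, goal_cases)
  case (1 f g h)
  then have "integrable nu (\<lambda>x. f x * cnj (h x))" "integrable nu (\<lambda>x. g x * cnj (h x))"
    by (auto intro!: sq_int_prod_integrable simp: L2_rel_def)
  then show ?case by (simp add: distrib_right add_divide_distrib)
qed

lemma cinner_scale_left: "cinner (c *\<^sub>C f) g = c * cinner f g"
  by transfer (simp add: mult.assoc)

lemma cinner_commute: "cinner f g = cnj (cinner g f)"
proof (transfer, goal_cases)
  case (1 f g)
  have "cnj (LINT x|nu. g x * cnj (f x)) = (LINT x|nu. cnj (g x * cnj (f x)))"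
    by (rule Bochner_Integration.integral_cnj[symmetric])
  then show ?case by (simp add: mult.commute)
qed

instance
proof
  fix f g h :: L2_bGamma and r :: real and U :: "L2_bGamma set"
  show "dist f g = norm (f - g)"
    by (rule dist_L2_bGamma_def)
  show "sgn f = inverse (norm f) *\<^sub>R f"
    by (rule sgn_L2_bGamma_def)
  show "uniformity = (INF e\<in>{0<..}. principal {(x :: L2_bGamma, y). dist x y < e})"
    by (rule uniformity_L2_bGamma_def)
  show "open U \<longleftrightarrow> (\<forall>x\<in>U. \<forall>\<^sub>F (x', y) in uniformity. x' = x \<longrightarrow> y \<in> U)"
    by (rule open_L2_bGamma_def)
  show "inner f g = inner g f"
    unfolding inner_L2_bGamma_def by (subst cinner_commute) simp
  show "inner (f + g) h = inner f h + inner g h"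
    by (simp add: inner_L2_bGamma_def cinner_add_left)
  show "inner (r *\<^sub>R f) g = r * inner f g"
    by (simp add: inner_L2_bGamma_def scaleR_L2_bGamma_def cinner_scale_left)
  show "0 \<le> inner f f"
    by (simp add: inner_L2_bGamma_def cinner_self del: of_real_power)
  show "inner f f = 0 \<longleftrightarrow> f = 0"
    by (simp add: inner_L2_bGamma_def cinner_self norm_L2_eq_0 del: of_real_power)
  show "norm f = sqrt (inner f f)"
    by (simp add: inner_L2_bGamma_def cinner_self norm_L2_nonneg del: of_real_power)
qed

end

section \<open>Essentially bounded symbols and multiplication operators\<close>

definition Linf_bGamma :: "(complex \<times> complex \<Rightarrow> complex) set" where
  "Linf_bGamma = {\<phi> \<in> borel_measurable nu. \<exists>C. AE x in nu. cmod (\<phi> x) \<le> C}"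

text \<open>The value for a symbol outside \<^const>\<open>Linf_bGamma\<close> is irrelevant.\<close>

lift_definition mult_op :: "(complex \<times> complex \<Rightarrow> complex) \<Rightarrow> L2_bGamma \<Rightarrow> L2_bGamma"
  is "\<lambda>\<phi> f. if \<phi> \<in> Linf_bGamma then (\<lambda>x. \<phi> x * f x) else (\<lambda>_. 0)"
proof -
  fix \<phi> f g assume fg: "L2_rel f g"
  show "L2_rel (if \<phi> \<in> Linf_bGamma then (\<lambda>x. \<phi> x * f x) else (\<lambda>_. 0))
      (if \<phi> \<in> Linf_bGamma then (\<lambda>x. \<phi> x * g x) else (\<lambda>_. 0))"
  proof (cases "\<phi> \<in> Linf_bGamma")
    case True
    then obtain C where "\<phi> \<in> borel_measurable nu" "AE x in nu. cmod (\<phi> x) \<le> C"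
      by (auto simp: Linf_bGamma_def)
    moreover have "AE x in nu. \<phi> x * f x = \<phi> x * g x"
      using fg by (auto simp: L2_rel_def elim: eventually_mono)
    ultimately show ?thesis
      using fg True by (auto simp: L2_rel_def intro: sq_int_bounded_mult)
  qed (simp add: L2_rel_def sq_int_zero)
qed

definition sbar :: "complex \<times> complex \<Rightarrow> complex" where
  "sbar = (\<lambda>(s, p). cnj s)"

definition pbar :: "complex \<times> complex \<Rightarrow> complex" where
  "pbar = (\<lambda>(s, p). cnj p)"

lemma nu_fst: "fst \<in> borel_measurable nu" and nu_snd: "snd \<in> borel_measurable nu"
proof -
  have "fst \<in> borel_measurable (restrict_space borel bGamma)"
    "snd \<in> borel_measurable (restrict_space borel bGamma)"
    by (intro measurable_restrict_space1 borel_measurable_continuous_onI continuous_intros)+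
  then show "fst \<in> borel_measurable nu" "snd \<in> borel_measurable nu"
    using measurable_cong_sets[OF sets_nu refl] by auto
qed

lemma sbar_in_Linf: "sbar \<in> Linf_bGamma"
proof -
  have "cmod (sbar x) \<le> 2" if "x \<in> bGamma" for x
  proof -
    obtain z w where "x = (z + w, z * w)" "cmod z = 1" "cmod w = 1"
      using \<open>x \<in> bGamma\<close> by (auto simp: bGamma_def symm_map_def circle_def)
    then show ?thesis
      using norm_triangle_ineq[of z w] by (simp add: sbar_def flip: complex_cnj_add)
  qed
  then have "AE x in nu. cmod (sbar x) \<le> 2"
    by (intro AE_I2) (simp add: space_nu)
  moreover have "sbar \<in> borel_measurable nu"
    unfolding sbar_def case_prod_beta using nu_fst by measurable
  ultimately show ?thesis by (auto simp: Linf_bGamma_def)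
qed

lemma pbar_in_Linf: "pbar \<in> Linf_bGamma"
proof -
  have "cmod (pbar x) \<le> 1" if "x \<in> bGamma" for x
    using that by (auto simp: bGamma_def symm_map_def circle_def pbar_def norm_mult)
  then have "AE x in nu. cmod (pbar x) \<le> 1"
    by (intro AE_I2) (simp add: space_nu)
  moreover have "pbar \<in> borel_measurable nu"
    unfolding pbar_def case_prod_beta using nu_snd by measurable
  ultimately show ?thesis by (auto simp: Linf_bGamma_def)
qed

section \<open>The Hardy space and dual Toeplitz operators\<close>

text \<open>The unitary from \<^typ>\<open>L2_bGamma\<close> onto the antisymmetric functions in L2 of the torus, on
  representatives.\<close>

definition U_map :: "(complex \<times> complex \<Rightarrow> complex) \<Rightarrow> complex \<times> complex \<Rightarrow> complex" where
  "U_map f = (\<lambda>z. Jac z * f (symm_map z) / complex_of_real Jac_norm)"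

definition fourier_coeff :: "(complex \<times> complex \<Rightarrow> complex) \<Rightarrow> int \<Rightarrow> int \<Rightarrow> complex" where
  "fourier_coeff F i j = (LINT z|torus_measure. F z * cnj (fst z powi i * snd z powi j))"

lemma powi_measurable [measurable (raw)]:
  fixes f :: "'a \<Rightarrow> complex"
  assumes [measurable]: "f \<in> borel_measurable M"
  shows "(\<lambda>x. f x powi i) \<in> borel_measurable M"
  unfolding power_int_def by measurable

lemma U_map_measurable:
  assumes "f \<in> borel_measurable nu"
  shows "U_map f \<in> borel_measurable torus_measure"
proof -
  have "f \<in> borel_measurable (restrict_space borel bGamma)"
    using assms measurable_cong_sets[OF sets_nu refl] by auto
  then have [measurable]: "(\<lambda>z. f (symm_map z)) \<in> borel_measurable torus_measure"
    using measurable_comp[OF symm_map_measurable] by (simp add: comp_def)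
  show ?thesis unfolding U_map_def by measurable
qed

lemma U_map_cong_AE:
  assumes "AE x in nu. f x = g x"
  shows "AE z in torus_measure. U_map f z = U_map g z"
proof -
  have "symm_map \<in> measurable (density torus_measure (\<lambda>z. ennreal ((cmod (Jac z))\<^sup>2)))
      (restrict_space borel bGamma)"
    by measurable
  from AE_distrD[OF this assms[unfolded nu_def]]
  have "AE z in torus_measure. 0 < ennreal ((cmod (Jac z))\<^sup>2) \<longrightarrow> f (symm_map z) = g (symm_map z)"
    by (subst (asm) AE_density) measurable
  then show ?thesis
    by eventually_elim (auto simp: U_map_def)
qed

lift_definition fourier_U :: "L2_bGamma \<Rightarrow> int \<Rightarrow> int \<Rightarrow> complex"
  is "\<lambda>f. fourier_coeff (U_map f)"
proof (intro ext)
  fix f g i j assume fg: "L2_rel f g"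
  then have [measurable]: "U_map f \<in> borel_measurable torus_measure"
      "U_map g \<in> borel_measurable torus_measure"
    by (auto simp: L2_rel_def sq_int_def intro: U_map_measurable)
  have "AE z in torus_measure. U_map f z = U_map g z"
    using fg by (intro U_map_cong_AE) (simp add: L2_rel_def)
  then have "AE z in torus_measure. U_map f z * cnj (fst z powi i * snd z powi j)
      = U_map g z * cnj (fst z powi i * snd z powi j)"
    by eventually_elim simp
  then show "fourier_coeff (U_map f) i j = fourier_coeff (U_map g) i j"
    unfolding fourier_coeff_def by (intro integral_cong_AE) measurable
qed

text \<open>The Hardy space of the symmetrized bidisc, realized inside \<^typ>\<open>L2_bGamma\<close> by its boundary
  values.\<close>

definition H2 :: "L2_bGamma set" where
  "H2 = {f. \<forall>i j. fourier_U f i j \<noteq> 0 \<longrightarrow> i \<ge> 0 \<and> j \<ge> 0}"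

definition ortho_compl :: "L2_bGamma set \<Rightarrow> L2_bGamma set" where
  "ortho_compl S = {f. \<forall>g\<in>S. cinner f g = 0}"

abbreviation H2_perp :: "L2_bGamma set" where
  "H2_perp \<equiv> ortho_compl H2"

definition ortho_proj :: "L2_bGamma set \<Rightarrow> L2_bGamma \<Rightarrow> L2_bGamma" where
  "ortho_proj S f = (THE g. g \<in> S \<and> f - g \<in> ortho_compl S)"

definition dual_toeplitz :: "(complex \<times> complex \<Rightarrow> complex) \<Rightarrow> L2_bGamma \<Rightarrow> L2_bGamma" where
  "dual_toeplitz \<phi> f = mult_op \<phi> f - ortho_proj H2 (mult_op \<phi> f)"

text \<open>Operators on a closed subspace \<open>K\<close> are functions on the whole space of which only the values
  on \<open>K\<close> matter.\<close>

definition bounded_op_on :: "L2_bGamma set \<Rightarrow> (L2_bGamma \<Rightarrow> L2_bGamma) \<Rightarrow> bool" where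
  "bounded_op_on K A \<longleftrightarrow>
     (\<forall>f\<in>K. A f \<in> K) \<and>
     (\<forall>f\<in>K. \<forall>g\<in>K. A (f + g) = A f + A g) \<and>
     (\<forall>c. \<forall>f\<in>K. A (c *\<^sub>C f) = c *\<^sub>C A f) \<and>
     (\<exists>C. \<forall>f\<in>K. norm (A f) \<le> C * norm f)"

text \<open>For \<^term>\<open>A\<close> a bounded operator on a closed subspace \<^term>\<open>K\<close>, this is the Hilbert space adjoint of
  the operator \<^term>\<open>A\<close> on \<^term>\<open>K\<close>, not of an extension of it to the whole space.\<close>

definition adjoint_on :: "L2_bGamma set \<Rightarrow> (L2_bGamma \<Rightarrow> L2_bGamma) \<Rightarrow> L2_bGamma \<Rightarrow> L2_bGamma" where
  "adjoint_on K A g = (THE h. h \<in> K \<and> (\<forall>f\<in>K. cinner (A f) g = cinner f h))"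

end

(* On the boundary s = p * sbar, so multiplication by sbar and pbar leaves H2_perp invariant and pbar
   is unimodular there; this gives the relations for a dual Toeplitz operator. Conversely, the second
   relation makes <T (pbar^n f), pbar^n g> independent of n as soon as pbar^n f and pbar^n g lie in
   H2_perp, and the first relation makes this form compatible with multiplication by s and p and
   their conjugates. The vectors p^n T (pbar^n 1) converge, and their limit phi satisfies
   <T (pbar^n q), pbar^n g> = <q phi, g> for every polynomial q in s, p and their conjugates.
   Polynomials are dense, so |q phi| <= |T| |q| in norm, which forces phi to be essentially bounded by
   |T|, and T is the compression of multiplication by phi. *)

theory Submission
  imports Defs
begin

section \<open>Testing densities against squares of polynomials\<close>

text \<open>The constant 1 lies in \<open>H2\<close>, so T cannot be evaluated at the function that
  would reveal its symbol. Powers of \<open>pbar\<close> are the way out: \<open>pbar\<close> itself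
  lies in \<open>H2_perp\<close>, and the set of functions that some power of \<open>pbar\<close>
  carries into \<open>H2_perp\<close> is stable under \<open>sbar\<close> and \<open>pbar\<close>
  (which preserve \<open>H2_perp\<close>), under p (one more power suffices) and hence under s. So
  it contains all polynomials, and Fourier coefficients enter only to show that \<open>H2\<close> is
  a closed subspace, that s and p map it to itself, and that \<open>pbar\<close> is orthogonal to
  it. The candidate symbol is at first merely square integrable, so multiplication by it is not yet
  a bounded operator. Its essential bound and the density of polynomials come from one test: a real
  integrable g is nonnegative almost everywhere if the integral of q^2 g is nonnegative for every
  real polynomial q. The bound takes g = C^2 - |phi|^2; density takes, up to sign, the real and
  imaginary parts of a function orthogonal to all polynomials.\<close>

lemma integral_indicator_compact_nonneg:
  fixes g :: "'a::euclidean_space \<Rightarrow> real"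
  assumes N: "sets N = sets borel" and K: "compact K" "AE x in N. x \<in> K"
    and g: "integrable N g"
    and nonneg: "\<And>q. real_polynomial_function q \<Longrightarrow> 0 \<le> (LINT x|N. (q x)\<^sup>2 * g x)"
    and E: "compact E"
  shows "0 \<le> (LINT x|N. indicator E x * g x)"
\<comment> \<open>\<open>infdist x {}\<close> is 0, so for empty E the functions \<open>k n\<close>
  below would be constantly 1 instead of tending to the indicator.\<close>
proof (cases "E = {}")
  case False
  define k where "k n x = 1 / (1 + real n * infdist x E)" for n x
  have den: "1 + real n * infdist x E > 0" for n x
    using infdist_nonneg[of x E] by (smt (verit) mult_nonneg_nonneg of_nat_0_le_iff)
  have "continuous_on K (k n)" for n
    unfolding k_def using den by (intro continuous_intros continuous_on_infdist) (smt (verit))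
  then have "\<exists>q. real_polynomial_function q \<and> (\<forall>x\<in>K. \<bar>k n x - q x\<bar> < inverse (real (Suc n)))" for n
    by (rule Stone_Weierstrass_real_polynomial_function[OF K(1)]) auto
  then obtain q where q: "\<And>n. real_polynomial_function (q n)"
      "\<And>n x. x \<in> K \<Longrightarrow> \<bar>k n x - q n x\<bar> < inverse (real (Suc n))"
    by metis
  have k_lim: "(\<lambda>n. k n x) \<longlonglongrightarrow> indicator E x" for x
  proof (cases "x \<in> E")
    case True
    then show ?thesis by (simp add: k_def)
  next
    case out: False
    then have "infdist x E > 0"
      using E False in_closed_iff_infdist_zero[of E x] infdist_nonneg[of x E]
      by (metis compact_imp_closed less_eq_real_def)
    moreover have "(\<lambda>n. 1 / (1 + real n * d)) \<longlonglongrightarrow> 0" if "d > 0" for d :: real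
      using that by real_asymp
    ultimately show ?thesis using out by (simp add: k_def)
  qed
  have "continuous_on UNIV (q n)" for n
    using q(1) by (simp add: continuous_on_polymonial_function real_polynomial_function_eq)
  then have [measurable]: "q n \<in> borel_measurable N" for n
    using measurable_cong_sets[OF N refl] borel_measurable_continuous_onI by blast
  have [measurable]: "g \<in> borel_measurable N" using g by auto
  have "E \<in> sets N" using E N by (simp add: borel_compact)
  note [measurable] = this
  \<comment> \<open>The squares keep the limit, because an indicator equals its own square. On K the
    approximated \<open>k n\<close> is at most 1 and the error at most 1, so \<open>q n\<close> is
    at most 2 in modulus; this gives the dominating factor 4.\<close>
  have "(\<lambda>n. LINT x|N. (q n x)\<^sup>2 * g x) \<longlonglongrightarrow> (LINT x|N. indicator E x * g x)"
  proof (rule integral_dominated_convergence[where w = "\<lambda>x. 4 * \<bar>g x\<bar>"])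
    show "AE x in N. (\<lambda>n. (q n x)\<^sup>2 * g x) \<longlonglongrightarrow> indicator E x * g x"
      using K(2)
    proof eventually_elim
      case (elim x)
      have "(\<lambda>n. k n x - q n x) \<longlonglongrightarrow> 0"
        using q(2)[OF elim]
        by (intro Lim_null_comparison[OF _ LIMSEQ_inverse_real_of_nat] always_eventually)
          (auto intro: less_imp_le)
      from tendsto_diff[OF k_lim[of x] this] have "(\<lambda>n. q n x) \<longlonglongrightarrow> indicator E x" by simp
      then have "(\<lambda>n. (q n x)\<^sup>2 * g x) \<longlonglongrightarrow> (indicator E x)\<^sup>2 * g x"
        by (intro tendsto_intros)
      then show ?case by (cases "x \<in> E") simp_all
    qed
    show "AE x in N. norm ((q n x)\<^sup>2 * g x) \<le> 4 * \<bar>g x\<bar>" for n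
      using K(2)
    proof eventually_elim
      case (elim x)
      have "\<bar>k n x\<bar> \<le> 1"
        using den[of n x] infdist_nonneg[of x E] by (simp add: k_def)
      moreover have "inverse (real (Suc n)) \<le> 1" by (simp add: field_simps)
      ultimately have "\<bar>q n x\<bar> \<le> 2" using q(2)[OF elim, of n] by linarith
      then have "\<bar>q n x\<bar>\<^sup>2 \<le> 2\<^sup>2" by (intro power_mono) auto
      then show ?case by (auto simp: abs_mult intro!: mult_right_mono)
    qed
  qed (use g in auto)
  then show ?thesis
    by (rule LIMSEQ_le_const) (use nonneg q(1) in auto)
qed simp

text \<open>Positive and negative parts of g are densities of two finite measures \<open>pos\<close>
  and \<open>neg\<close>. The compact case says that \<open>neg\<close> is below \<open>pos\<close>
  on compact sets; inner regularity of \<open>neg\<close> extends this to all Borel sets, which is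
  nonnegativity of every set integral of g.\<close>

lemma AE_nonneg_if_squares_nonneg:
  fixes g :: "'a::euclidean_space \<Rightarrow> real"
  assumes fin: "finite_measure N" and N: "sets N = sets borel" and K: "compact K" "AE x in N. x \<in> K"
    and g: "integrable N g"
    and nonneg: "\<And>q. real_polynomial_function q \<Longrightarrow> 0 \<le> (LINT x|N. (q x)\<^sup>2 * g x)"
  shows "AE x in N. 0 \<le> g x"
proof -
  interpret finite_measure N by (rule fin)
  have gm [measurable]: "g \<in> borel_measurable N" using g by auto
  define pos where "pos = density N (\<lambda>x. ennreal (max 0 (g x)))"
  define neg where "neg = density N (\<lambda>x. ennreal (max 0 (- g x)))"
  have int: "integrable N (\<lambda>x. indicator A x * max 0 (g x))"
    "integrable N (\<lambda>x. indicator A x * max 0 (- g x))" if [measurable]: "A \<in> sets N" for A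
    by (rule Bochner_Integration.integrable_bound[OF g]; auto simp: indicator_def)+
  have pos: "emeasure pos A = ennreal (LINT x|N. indicator A x * max 0 (g x))"
    and neg: "emeasure neg A = ennreal (LINT x|N. indicator A x * max 0 (- g x))"
    if [measurable]: "A \<in> sets N" for A
    unfolding pos_def neg_def
    by (auto simp: emeasure_density nn_integral_eq_integral[OF int(1)[OF that], symmetric]
        nn_integral_eq_integral[OF int(2)[OF that], symmetric] ennreal_indicator
        ennreal_mult' mult.commute intro!: nn_integral_cong)
  have split: "(LINT x|N. indicator A x * g x)
      = (LINT x|N. indicator A x * max 0 (g x)) - (LINT x|N. indicator A x * max 0 (- g x))"
    if "A \<in> sets N" for A
    by (subst Bochner_Integration.integral_diff[OF int[OF that], symmetric])
      (auto intro!: Bochner_Integration.integral_cong simp: max_def)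
  show ?thesis
  proof (rule density_nonneg[OF g])
    fix A assume A: "A \<in> sets N"
    have "emeasure neg A = (SUP E \<in> {E. E \<subseteq> A \<and> compact E}. emeasure neg E)"
    proof (rule inner_regular)
      show "sets neg = sets borel" "A \<in> sets borel" using A N by (auto simp: neg_def)
      show "emeasure neg (space neg) \<noteq> \<infinity>" using neg[OF sets.top] by (simp add: neg_def)
    qed
    also have "\<dots> \<le> emeasure pos A"
    proof (rule SUP_least)
      fix E assume "E \<in> {E. E \<subseteq> A \<and> compact E}"
      then have E: "E \<subseteq> A" "compact E" "E \<in> sets N" by (auto simp: N borel_compact)
      have "emeasure neg E \<le> emeasure pos E"
        using integral_indicator_compact_nonneg[OF N K g nonneg E(2)] E(3)
        by (auto simp: pos neg split intro!: ennreal_leI)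
      also have "\<dots> \<le> emeasure pos A"
        using E A by (intro emeasure_mono) (auto simp: pos_def)
      finally show "emeasure neg E \<le> emeasure pos A" .
    qed
    finally have "(LINT x|N. indicator A x * max 0 (- g x)) \<le> (LINT x|N. indicator A x * max 0 (g x))"
      unfolding pos[OF A] neg[OF A]
      by (subst (asm) ennreal_le_iff) (auto intro!: Bochner_Integration.integral_nonneg)
    then show "0 \<le> set_lebesgue_integral N A g"
      using split[OF A] by (simp add: set_lebesgue_integral_def)
  qed
qed

section \<open>Orthogonal projections in a real Hilbert space\<close>

lemma parallelogram_midpoint:
  fixes f s t :: "'a::real_inner"
  shows "(norm (s - t))\<^sup>2
    = 2 * (norm (f - s))\<^sup>2 + 2 * (norm (f - t))\<^sup>2 - 4 * (norm (f - (1/2) *\<^sub>R (s + t)))\<^sup>2"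
  unfolding power2_norm_eq_inner
  by (simp add: inner_diff_left inner_diff_right inner_add_left inner_add_right inner_commute
      algebra_simps)

lemma subspace_projection:
  fixes S :: "'a::{real_inner,complete_space} set"
  assumes S: "subspace S" "closed S"
  obtains g where "g \<in> S" "\<And>h. h \<in> S \<Longrightarrow> inner (f - g) h = 0"
proof -
  define d where "d = infdist f S"
  have ne: "S \<noteq> {}" using S(1) subspace_0 by blast
  have d: "d \<le> norm (f - s)" if "s \<in> S" for s
    using that by (simp add: d_def infdist_le flip: dist_norm)
  have "\<exists>s\<in>S. norm (f - s) < d + inverse (real (Suc n))" for n
  proof -
    have "(INF s\<in>S. dist f s) < d + inverse (real (Suc n))"
      using ne by (simp add: d_def infdist_def)
    then show ?thesis
      using ne by (subst (asm) cINF_less_iff) (auto simp: dist_norm intro: bdd_belowI2[where m = 0])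
  qed
  then obtain s where s: "\<And>n. s n \<in> S" "\<And>n. norm (f - s n) < d + inverse (real (Suc n))"
    by metis
  have lim: "(\<lambda>n. norm (f - s n)) \<longlonglongrightarrow> d"
  proof (rule tendsto_sandwich[of "\<lambda>_. d" _ _ "\<lambda>n. d + inverse (real (Suc n))"])
    show "(\<lambda>n. d + inverse (real (Suc n))) \<longlonglongrightarrow> d"
      using tendsto_add[OF tendsto_const LIMSEQ_inverse_real_of_nat] by simp
    show "\<forall>\<^sub>F n in sequentially. norm (f - s n) \<le> d + inverse (real (Suc n))"
      using s(2) by (intro always_eventually) (auto intro: less_imp_le)
  qed (use d s(1) in auto)
  have "Cauchy s"
    unfolding Cauchy_def
  proof (intro allI impI)
    fix e :: real assume "e > 0"
    have "(\<lambda>n. (norm (f - s n))\<^sup>2) \<longlonglongrightarrow> d\<^sup>2" by (intro tendsto_intros lim)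
    \<comment> \<open>The slack e^2/4 occurs twice with factor 2 in the parallelogram identity, and
      the midpoint term removes 4 d^2, leaving exactly e^2.\<close>
    then have "\<forall>\<^sub>F n in sequentially. (norm (f - s n))\<^sup>2 < d\<^sup>2 + e\<^sup>2 / 4"
      by (rule order_tendstoD) (use \<open>e > 0\<close> in simp)
    then obtain M where M: "\<And>n. n \<ge> M \<Longrightarrow> (norm (f - s n))\<^sup>2 < d\<^sup>2 + e\<^sup>2 / 4"
      by (auto simp: eventually_sequentially)
    show "\<exists>M. \<forall>m\<ge>M. \<forall>n\<ge>M. dist (s m) (s n) < e"
    proof (intro exI allI impI)
      fix m n assume mn: "M \<le> m" "M \<le> n"
      have "(1/2) *\<^sub>R (s m + s n) \<in> S"
        using S(1) s(1) by (intro subspace_mul subspace_add)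
      from d[OF this] have "d\<^sup>2 \<le> (norm (f - (1/2) *\<^sub>R (s m + s n)))\<^sup>2"
        by (intro power_mono) (auto simp: d_def infdist_nonneg)
      then have "(norm (s m - s n))\<^sup>2 < e\<^sup>2"
        using parallelogram_midpoint[of "s m" "s n" f] M[OF mn(1)] M[OF mn(2)] by linarith
      then show "dist (s m) (s n) < e"
        using \<open>e > 0\<close> by (simp add: dist_norm power2_less_imp_less)
    qed
  qed
  then obtain g where g: "s \<longlonglongrightarrow> g" using Cauchy_convergent convergentD by blast
  have gS: "g \<in> S" using S(2) g s(1) closed_sequentially by blast
  have "(\<lambda>n. norm (f - s n)) \<longlonglongrightarrow> norm (f - g)" by (intro tendsto_intros g)
  then have gd: "norm (f - g) = d" using lim LIMSEQ_unique by blast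
  have "inner (f - g) h = 0" if h: "h \<in> S" for h
  proof (cases "h = 0")
    case False
    \<comment> \<open>This t minimizes the squared distance from f to g + t h; moving there would
      lower it by t^2 |h|^2, which minimality of g allows only for t = 0.\<close>
    define t where "t = inner (f - g) h / (norm h)\<^sup>2"
    have "g + t *\<^sub>R h \<in> S" using S(1) gS h by (intro subspace_add subspace_mul)
    from d[OF this] have "(norm (f - g))\<^sup>2 \<le> (norm (f - (g + t *\<^sub>R h)))\<^sup>2"
      unfolding gd by (intro power_mono) (auto simp: d_def infdist_nonneg)
    also have "\<dots> = (norm (f - g))\<^sup>2 - 2 * t * inner (f - g) h + t\<^sup>2 * (norm h)\<^sup>2"
      unfolding power2_norm_eq_inner
      by (simp add: inner_diff_left inner_diff_right inner_add_left inner_add_right inner_commute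
          algebra_simps power2_eq_square)
    finally have "2 * t * inner (f - g) h \<le> t\<^sup>2 * (norm h)\<^sup>2" by simp
    moreover have "inner (f - g) h = t * (norm h)\<^sup>2" using False by (simp add: t_def)
    ultimately have "t\<^sup>2 * (norm h)\<^sup>2 \<le> 0" by (simp add: power2_eq_square algebra_simps)
    then show ?thesis using False
      by (simp add: \<open>inner (f - g) h = t * (norm h)\<^sup>2\<close> mult_le_0_iff)
  qed simp
  then show thesis using gS that by blast
qed

section \<open>Completeness of the space of square integrable functions\<close>

lemma square_integrable_diff:
  fixes f g :: "'a \<Rightarrow> complex"
  assumes [measurable]: "f \<in> borel_measurable M" "g \<in> borel_measurable M"
    and int: "integrable M (\<lambda>x. (cmod (f x))\<^sup>2)" "integrable M (\<lambda>x. (cmod (g x))\<^sup>2)"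
  shows "integrable M (\<lambda>x. (cmod (f x - g x))\<^sup>2)"
proof (rule Bochner_Integration.integrable_bound)
  show "integrable M (\<lambda>x. 2 * (cmod (f x))\<^sup>2 + 2 * (cmod (g x))\<^sup>2)"
    using int by simp
  have "(cmod (a - b))\<^sup>2 \<le> 2 * (cmod a)\<^sup>2 + 2 * (cmod b)\<^sup>2" for a b
  proof -
    have "(cmod (a - b))\<^sup>2 \<le> (cmod a + cmod b)\<^sup>2"
      by (intro power_mono norm_triangle_ineq4) auto
    also have "\<dots> \<le> 2 * (cmod a)\<^sup>2 + 2 * (cmod b)\<^sup>2"
      using zero_le_power2[of "cmod a - cmod b"] by (simp add: power2_sum power2_diff)
    finally show ?thesis .
  qed
  then show "AE x in M. norm ((cmod (f x - g x))\<^sup>2) \<le> norm (2 * (cmod (f x))\<^sup>2 + 2 * (cmod (g x))\<^sup>2)"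
    by auto
qed measurable

text \<open>Integrates 2|f| \<le> t + |f|^2 / t. The free t stands in for the optimization in
  Cauchy-Schwarz: it is taken as 2^-k for the increments of a fast subsequence and as the norm of f
  in \<open>fourier_U_bound\<close>.\<close>

lemma (in finite_measure) integral_norm_le_square:
  fixes f :: "'a \<Rightarrow> complex"
  assumes [measurable]: "f \<in> borel_measurable M" and int: "integrable M (\<lambda>x. (cmod (f x))\<^sup>2)"
    and t: "t > 0"
  shows "integrable M f"
    and "(LINT x|M. cmod (f x)) \<le> (t * measure M (space M) + (LINT x|M. (cmod (f x))\<^sup>2) / t) / 2"
proof -
  have amgm: "cmod (f x) \<le> (t + (cmod (f x))\<^sup>2 / t) / 2" for x
    using t zero_le_power2[of "cmod (f x) - t"] by (simp add: field_simps power2_eq_square)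
  have rhs: "integrable M (\<lambda>x. (t + (cmod (f x))\<^sup>2 / t) / 2)"
    using int by simp
  show f: "integrable M f"
    by (rule Bochner_Integration.integrable_bound[OF rhs])
      (use order_trans[OF amgm abs_ge_self] in auto)
  have "(LINT x|M. cmod (f x)) \<le> (LINT x|M. (t + (cmod (f x))\<^sup>2 / t) / 2)"
    using f rhs amgm by (intro integral_mono) auto
  also have "\<dots> = (t * measure M (space M) + (LINT x|M. (cmod (f x))\<^sup>2) / t) / 2"
    using int by simp
  finally show "(LINT x|M. cmod (f x)) \<le> (t * measure M (space M) + (LINT x|M. (cmod (f x))\<^sup>2) / t) / 2" .
qed

lemma AE_summable_of_summable_integral:
  fixes d :: "nat \<Rightarrow> 'a \<Rightarrow> complex"
  assumes d: "\<And>k. integrable M (d k)" and s: "summable (\<lambda>k. LINT x|M. cmod (d k x))"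
  shows "AE x in M. summable (\<lambda>k. d k x)"
proof -
  have [measurable]: "d k \<in> borel_measurable M" for k using d by auto
  have "(\<integral>\<^sup>+x. (\<Sum>k. ennreal (cmod (d k x))) \<partial>M) = (\<Sum>k. \<integral>\<^sup>+x. ennreal (cmod (d k x)) \<partial>M)"
    by (intro nn_integral_suminf) auto
  also have "\<dots> = (\<Sum>k. ennreal (LINT x|M. cmod (d k x)))"
    using d by (intro suminf_cong nn_integral_eq_integral) auto
  also have "\<dots> < \<infinity>"
    using s by (simp add: ennreal_suminf_neq_top less_top[symmetric])
  finally have "AE x in M. (\<Sum>k. ennreal (cmod (d k x))) \<noteq> \<infinity>"
    by (intro nn_integral_noteq_infinite) auto
  then show ?thesis
  proof eventually_elim
    case (elim x)
    then have "summable (\<lambda>k. norm (d k x))"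
      by (intro summable_suminf_not_top) auto
    then show ?case by (rule summable_norm_cancel)
  qed
qed

text \<open>A fast subsequence has increments summable in L1 and so converges almost everywhere;
  Fatou's lemma along that subsequence then carries the Cauchy estimate over to the limit F.\<close>

lemma (in finite_measure) L2_Cauchy_limit:
  fixes f :: "nat \<Rightarrow> 'a \<Rightarrow> complex"
  assumes [measurable]: "\<And>n. f n \<in> borel_measurable M"
    and int: "\<And>n. integrable M (\<lambda>x. (cmod (f n x))\<^sup>2)"
    and Cauchy: "\<And>e. e > 0 \<Longrightarrow> \<exists>N. \<forall>m\<ge>N. \<forall>n\<ge>N. (LINT x|M. (cmod (f m x - f n x))\<^sup>2) < e"
  obtains F where "F \<in> borel_measurable M"
    "\<And>e. e > 0 \<Longrightarrow> \<exists>N. \<forall>n\<ge>N. integrable M (\<lambda>x. (cmod (F x - f n x))\<^sup>2)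
        \<and> (LINT x|M. (cmod (F x - f n x))\<^sup>2) \<le> e"
proof -
  have int': "integrable M (\<lambda>x. (cmod (f m x - f n x))\<^sup>2)" for m n
    by (intro square_integrable_diff int) auto
  \<comment> \<open>Squared distances below 4^-k combined with t = 2^-k make both terms of the L1
    estimate of order 2^-k.\<close>
  have "\<exists>N. \<forall>m\<ge>N. \<forall>n\<ge>N. (LINT x|M. (cmod (f m x - f n x))\<^sup>2) < (1/4)^k" for k :: nat
    by (rule Cauchy) simp
  then obtain N where N: "\<And>k m n. m \<ge> N k \<Longrightarrow> n \<ge> N k \<Longrightarrow> (LINT x|M. (cmod (f m x - f n x))\<^sup>2) < (1/4)^k"
    by metis
  \<comment> \<open>The maximum makes r monotone and at least N k; the added k makes it at least k,
    so that the subsequence passes every index L in the Fatou argument.\<close>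
  define r where "r k = Max (N ` {..k}) + k" for k
  have rN: "r k \<ge> N k" for k unfolding r_def by (intro trans_le_add1 Max_ge) auto
  have r_mono: "r k \<le> r l" if "k \<le> l" for k l
    unfolding r_def using that by (intro add_mono Max_mono) auto
  have rk: "k \<le> r k" for k by (simp add: r_def)
  define d where "d k x = f (r (Suc k)) x - f (r k) x" for k x
  have [measurable]: "d k \<in> borel_measurable M" for k unfolding d_def by measurable
  have d2: "(LINT x|M. (cmod (d k x))\<^sup>2) < (1/4)^k" for k
    unfolding d_def using rN[of k] r_mono[of k "Suc k"] by (intro N) auto
  have di: "integrable M (\<lambda>x. (cmod (d k x))\<^sup>2)" for k unfolding d_def by (rule int')
  have d_int: "integrable M (d k)" for k
    by (rule integral_norm_le_square(1)[OF _ di zero_less_one]) simp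
  have d1: "(LINT x|M. cmod (d k x)) \<le> (measure M (space M) + 1) / 2 * (1/2)^k" for k
  proof -
    have "(LINT x|M. cmod (d k x))
        \<le> ((1/2)^k * measure M (space M) + (LINT x|M. (cmod (d k x))\<^sup>2) / (1/2)^k) / 2"
      by (rule integral_norm_le_square(2)) (auto simp: di)
    also have "\<dots> \<le> ((1/2)^k * measure M (space M) + (1/4)^k / (1/2)^k) / 2"
      using d2[of k] by (intro divide_right_mono add_left_mono) auto
    also have "\<dots> = (measure M (space M) + 1) / 2 * (1/2)^k"
      by (simp add: field_simps flip: power_mult_distrib)
    finally show ?thesis .
  qed
  have "summable (\<lambda>k. LINT x|M. cmod (d k x))"
    by (rule summable_comparison_test'[where N = 0 and g = "\<lambda>k. (measure M (space M) + 1) / 2 * (1/2)^k"])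
      (use d1 in \<open>auto intro!: summable_mult summable_geometric\<close>)
  from AE_summable_of_summable_integral[OF d_int this]
  have conv: "AE x in M. convergent (\<lambda>k. f (r k) x)"
  proof eventually_elim
    case (elim x)
    have "(\<Sum>i<k. d i x) + f (r 0) x = f (r k) x" for k
      unfolding d_def by (subst sum_lessThan_telescope) simp
    moreover have "convergent (\<lambda>k. (\<Sum>i<k. d i x) + f (r 0) x)"
      using elim by (intro convergent_add convergent_const) (simp add: summable_iff_convergent)
    ultimately show ?case by simp
  qed
  define F where "F x = lim (\<lambda>k. f (r k) x)" for x
  have F [measurable]: "F \<in> borel_measurable M"
    unfolding F_def by (intro borel_measurable_lim_metric) simp
  have lim: "AE x in M. (\<lambda>k. f (r k) x) \<longlonglongrightarrow> F x"
    using conv by eventually_elim (simp add: F_def convergent_LIMSEQ_iff)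
  have bound: "integrable M (\<lambda>x. (cmod (F x - f n x))\<^sup>2) \<and> (LINT x|M. (cmod (F x - f n x))\<^sup>2) \<le> e"
    if e: "e > 0" and n: "\<And>m. m \<ge> L \<Longrightarrow> (LINT x|M. (cmod (f m x - f n x))\<^sup>2) < e" for e n L
  proof -
    have "(\<integral>\<^sup>+x. ennreal ((cmod (F x - f n x))\<^sup>2) \<partial>M)
        = (\<integral>\<^sup>+x. liminf (\<lambda>k. ennreal ((cmod (f (r k) x - f n x))\<^sup>2)) \<partial>M)"
    proof (rule nn_integral_cong_AE)
      show "AE x in M. ennreal ((cmod (F x - f n x))\<^sup>2)
          = liminf (\<lambda>k. ennreal ((cmod (f (r k) x - f n x))\<^sup>2))"
        using lim
      proof eventually_elim
        case (elim x)
        then have "(\<lambda>k. ennreal ((cmod (f (r k) x - f n x))\<^sup>2)) \<longlonglongrightarrow> ennreal ((cmod (F x - f n x))\<^sup>2)"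
          by (intro tendsto_ennrealI tendsto_intros)
        then show ?case by (metis lim_imp_Liminf sequentially_bot)
      qed
    qed
    also have "\<dots> \<le> liminf (\<lambda>k. \<integral>\<^sup>+x. ennreal ((cmod (f (r k) x - f n x))\<^sup>2) \<partial>M)"
      by (intro nn_integral_liminf) auto
    also have "\<dots> = liminf (\<lambda>k. ennreal (LINT x|M. (cmod (f (r k) x - f n x))\<^sup>2))"
      using int' by (subst nn_integral_eq_integral) auto
    also have "\<dots> \<le> liminf (\<lambda>k::nat. ennreal e)"
    proof (intro Liminf_mono eventually_sequentiallyI)
      show "ennreal (LINT x|M. (cmod (f (r k) x - f n x))\<^sup>2) \<le> ennreal e" if "k \<ge> L" for k
        using n[of "r k"] rk[of k] that by (intro ennreal_leI) auto
    qed
    also have "\<dots> = ennreal e" by (simp add: Liminf_const)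
    finally have le: "(\<integral>\<^sup>+x. ennreal ((cmod (F x - f n x))\<^sup>2) \<partial>M) \<le> ennreal e" .
    then have i: "integrable M (\<lambda>x. (cmod (F x - f n x))\<^sup>2)"
      by (intro integrableI_bounded) (auto intro: le_less_trans)
    show ?thesis
      using i le e by (subst (asm) nn_integral_eq_integral) auto
  qed
  show thesis
  proof (rule that[OF F])
    fix e :: real assume e: "e > 0"
    then obtain L where "\<forall>m\<ge>L. \<forall>n\<ge>L. (LINT x|M. (cmod (f m x - f n x))\<^sup>2) < e" using Cauchy by blast
    then show "\<exists>N. \<forall>n\<ge>N. integrable M (\<lambda>x. (cmod (F x - f n x))\<^sup>2)
        \<and> (LINT x|M. (cmod (F x - f n x))\<^sup>2) \<le> e"
      using bound[OF e] by blast
  qed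
qed

section \<open>Completeness of \<open>L2_bGamma\<close>\<close>

lemma finite_measure_nu: "finite_measure nu"
proof (rule finite_measureI)
  have "emeasure nu (space nu) = (\<integral>\<^sup>+ z\<in>symm_map -` space nu \<inter> space torus_measure.
      ennreal ((cmod (Jac z))\<^sup>2) \<partial>torus_measure)"
    by (rule emeasure_nu) simp
  also have "\<dots> \<le> (\<integral>\<^sup>+ z. ennreal ((cmod (Jac z))\<^sup>2) \<partial>torus_measure)"
    by (intro nn_integral_mono) (auto simp: indicator_def)
  also have "\<dots> < \<infinity>"
    using integrable_Jac by (subst nn_integral_eq_integral) auto
  finally show "emeasure nu (space nu) \<noteq> \<infinity>" by auto
qed

lemma L2_rel_refl_iff: "L2_rel f f \<longleftrightarrow> sq_int f"
  by (simp add: L2_rel_def)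

lemma L2_bGamma_cases [case_names abs]:
  obtains f where "sq_int f" "x = abs_L2_bGamma f"
  by (induction x rule: L2_bGamma.abs_induct) (auto simp: L2_rel_refl_iff)

lemma norm_abs_L2: "sq_int f \<Longrightarrow> (norm (abs_L2_bGamma f))\<^sup>2 = (LINT x|nu. (cmod (f x))\<^sup>2) / 2"
  by (simp add: norm_L2_bGamma.abs_eq L2_rel_refl_iff power_divide Jac_norm_square)

instance L2_bGamma :: complete_space
proof
  fix X :: "nat \<Rightarrow> L2_bGamma" assume X: "Cauchy X"
  have "\<exists>f. sq_int f \<and> X n = abs_L2_bGamma f" for n
    by (cases "X n" rule: L2_bGamma_cases) auto
  then obtain f where f: "\<And>n. sq_int (f n)" and Xf: "\<And>n. X n = abs_L2_bGamma (f n)"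
    by metis
  have diff: "(norm (X m - X n))\<^sup>2 = (LINT x|nu. (cmod (f m x - f n x))\<^sup>2) / 2" for m n
    by (simp add: Xf minus_L2_bGamma.abs_eq L2_rel_refl_iff f norm_abs_L2 sq_int_diff)
  obtain F where F [measurable]: "F \<in> borel_measurable nu"
    and lim: "\<And>e. e > 0 \<Longrightarrow> \<exists>N. \<forall>n\<ge>N. integrable nu (\<lambda>x. (cmod (F x - f n x))\<^sup>2)
        \<and> (LINT x|nu. (cmod (F x - f n x))\<^sup>2) \<le> e"
  proof (rule finite_measure.L2_Cauchy_limit[OF finite_measure_nu, of f])
    fix e :: real assume "e > 0"
    \<comment> \<open>The squared norm is half the integral, so a norm below sqrt (e/2) means an
      integral below e.\<close>
    then obtain N where N: "\<And>m n. m \<ge> N \<Longrightarrow> n \<ge> N \<Longrightarrow> norm (X m - X n) < sqrt (e / 2)"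
      using X by (auto simp: Cauchy_def dist_norm dest!: spec[of _ "sqrt (e / 2)"])
    have "(LINT x|nu. (cmod (f m x - f n x))\<^sup>2) < e" if "m \<ge> N" "n \<ge> N" for m n
    proof -
      have "(norm (X m - X n))\<^sup>2 < (sqrt (e / 2))\<^sup>2"
        using N[OF that] by (intro power_strict_mono) auto
      then show ?thesis using \<open>e > 0\<close> by (simp add: diff)
    qed
    then show "\<exists>N. \<forall>m\<ge>N. \<forall>n\<ge>N. (LINT x|nu. (cmod (f m x - f n x))\<^sup>2) < e" by blast
  qed (use f in \<open>auto simp: sq_int_def\<close>)
  have Ff: "sq_int (\<lambda>x. F x - f n x)" if "integrable nu (\<lambda>x. (cmod (F x - f n x))\<^sup>2)" for n
    using that f[of n] by (auto simp: sq_int_def)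
  obtain n where "integrable nu (\<lambda>x. (cmod (F x - f n x))\<^sup>2)"
    using lim[of 1] by auto
  from sq_int_add[OF Ff[OF this] f[of n]] have sqF: "sq_int F" by simp
  have "X \<longlonglongrightarrow> abs_L2_bGamma F"
  proof (rule metric_LIMSEQ_I)
    fix e :: real assume e: "e > 0"
    obtain N where N: "\<And>n. n \<ge> N \<Longrightarrow> (LINT x|nu. (cmod (F x - f n x))\<^sup>2) \<le> e\<^sup>2"
      using lim[of "e\<^sup>2"] e by auto
    have "dist (X n) (abs_L2_bGamma F) < e" if "n \<ge> N" for n
    proof -
      have "(norm (abs_L2_bGamma F - X n))\<^sup>2 = (LINT x|nu. (cmod (F x - f n x))\<^sup>2) / 2"
        by (simp add: Xf minus_L2_bGamma.abs_eq L2_rel_refl_iff f sqF norm_abs_L2 sq_int_diff)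
      also have "\<dots> < e\<^sup>2" using N[OF that] e by (smt (verit) field_sum_of_halves zero_less_power)
      finally show ?thesis
        using e by (simp add: dist_norm norm_minus_commute power2_less_imp_less)
    qed
    then show "\<exists>N. \<forall>n\<ge>N. dist (X n) (abs_L2_bGamma F) < e" by blast
  qed
  then show "convergent X" by (rule convergentI)
qed

section \<open>The complex Hilbert space structure\<close>

lemma cinner_add_right: "cinner f (g + h) = cinner f g + cinner f h"
  using cinner_commute[of f "g + h"] cinner_commute[of f g] cinner_commute[of f h]
  by (simp add: cinner_add_left)

lemma cinner_scale_right: "cinner f (c *\<^sub>C g) = cnj c * cinner f g"
  using cinner_commute[of f "c *\<^sub>C g"] cinner_commute[of f g]
  by (simp add: cinner_scale_left)

lemma cinner_zero_left [simp]: "cinner 0 g = 0"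
  using cinner_add_left[of 0 0 g] by simp

lemma cinner_diff_left: "cinner (f - g) h = cinner f h - cinner g h"
  using cinner_add_left[of "f - g" g h] by simp

lemma cinner_diff_right: "cinner f (g - h) = cinner f g - cinner f h"
  using cinner_add_right[of f "g - h" h] by simp

lemma cinner_eq_0_commute: "cinner f g = 0 \<longleftrightarrow> cinner g f = 0"
  using cinner_commute[of f g] by simp

lemma cinner_self_eq_0: "cinner f f = 0 \<longleftrightarrow> f = 0"
  by (simp add: cinner_self)

lemma cscale_add_right: "c *\<^sub>C (f + g) = c *\<^sub>C f + c *\<^sub>C g"
  by transfer (simp add: L2_rel_def sq_int_add sq_int_cmult distrib_left)

lemma cscale_diff_right: "c *\<^sub>C (f - g) = c *\<^sub>C f - c *\<^sub>C g"
  using cscale_add_right[of c "f - g" g] by simp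

lemma cscale_one: "1 *\<^sub>C f = f"
  by transfer (simp add: L2_rel_def)

lemma cscale_zero: "c *\<^sub>C 0 = 0"
  by transfer (simp add: L2_rel_def sq_int_zero)

lemma cscale_zero_left: "0 *\<^sub>C f = 0"
  by transfer (simp add: L2_rel_def sq_int_zero)

lemma uminus_eq_cscale: "- f = (- 1) *\<^sub>C f"
  by transfer (simp add: L2_rel_def sq_int_minus)

lemma norm_cscale: "norm (c *\<^sub>C f) = cmod c * norm f"
proof -
  have "complex_of_real ((norm (c *\<^sub>C f))\<^sup>2) = c * cnj c * complex_of_real ((norm f)\<^sup>2)"
    unfolding cinner_self[symmetric] by (simp add: cinner_scale_left cinner_scale_right)
  also have "\<dots> = complex_of_real ((cmod c * norm f)\<^sup>2)"
    by (simp add: complex_norm_square power_mult_distrib del: of_real_power)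
  finally have "(norm (c *\<^sub>C f))\<^sup>2 = (cmod c * norm f)\<^sup>2"
    using of_real_eq_iff by blast
  then show ?thesis by (simp add: power2_eq_iff_nonneg)
qed

text \<open>Rotating f by a unimodular c makes the inner product real and nonnegative, which reduces
  the claim to the inequality for the real inner product.\<close>

lemma cinner_Cauchy_Schwarz: "cmod (cinner f g) \<le> norm f * norm g"
proof (cases "cinner f g = 0")
  case False
  define c where "c = cnj (sgn (cinner f g))"
  have c: "cmod c = 1" using False by (simp add: c_def norm_sgn)
  have "c * cinner f g = complex_of_real (cmod (cinner f g))"
    using False by (simp add: c_def sgn_eq complex_norm_square[symmetric] power2_eq_square field_simps)
  then have "cmod (cinner f g) = inner (c *\<^sub>C f) g"
    by (simp add: inner_L2_bGamma_def cinner_scale_left)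
  also have "\<dots> \<le> norm (c *\<^sub>C f) * norm g" by (rule norm_cauchy_schwarz)
  finally show ?thesis by (simp add: norm_cscale c)
qed simp

definition csubspace :: "L2_bGamma set \<Rightarrow> bool" where
  "csubspace S \<longleftrightarrow> 0 \<in> S \<and> (\<forall>f\<in>S. \<forall>g\<in>S. f + g \<in> S) \<and> (\<forall>c. \<forall>f\<in>S. c *\<^sub>C f \<in> S)"

lemma csubspace_diff: "csubspace S \<Longrightarrow> f \<in> S \<Longrightarrow> g \<in> S \<Longrightarrow> f - g \<in> S"
  unfolding csubspace_def using uminus_eq_cscale[of g] by (simp flip: add_uminus_conv_diff)

lemma csubspace_imp_subspace: "csubspace S \<Longrightarrow> subspace S"
  by (simp add: csubspace_def subspace_def scaleR_L2_bGamma_def)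

lemma csubspace_ortho_compl: "csubspace (ortho_compl S)"
  by (simp add: csubspace_def ortho_compl_def cinner_add_left cinner_scale_left)

lemma csubspace_closure:
  assumes S: "csubspace S"
  shows "csubspace (closure S)"
proof -
  have "c *\<^sub>C f \<in> closure S" if f: "f \<in> closure S" for c f
  proof -
    obtain X where X: "\<And>n. X n \<in> S" "X \<longlonglongrightarrow> f" using f unfolding closure_sequential by auto
    have "(\<lambda>n. c *\<^sub>C X n) \<longlonglongrightarrow> c *\<^sub>C f"
    proof (rule Lim_null_comparison[THEN LIM_zero_cancel])
      have "norm (c *\<^sub>C X n - c *\<^sub>C f) = cmod c * norm (X n - f)" for n
        by (simp add: norm_cscale flip: cscale_diff_right)
      then show "\<forall>\<^sub>F n in sequentially. norm (c *\<^sub>C X n - c *\<^sub>C f) \<le> cmod c * norm (X n - f)" by simp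
      show "(\<lambda>n. cmod c * norm (X n - f)) \<longlonglongrightarrow> 0"
        using X(2) by (intro tendsto_mult_right_zero tendsto_norm_zero LIM_zero)
    qed
    moreover have "c *\<^sub>C X n \<in> S" for n using S X(1) by (simp add: csubspace_def)
    ultimately show ?thesis unfolding closure_sequential by (intro exI[of _ "\<lambda>n. c *\<^sub>C X n"]) simp
  qed
  moreover have "f + g \<in> closure S" if "f \<in> closure S" "g \<in> closure S" for f g
  proof -
    obtain X Y where "\<And>n. X n \<in> S" "X \<longlonglongrightarrow> f" "\<And>n. Y n \<in> S" "Y \<longlonglongrightarrow> g"
      using \<open>f \<in> closure S\<close> \<open>g \<in> closure S\<close> unfolding closure_sequential by auto
    then show ?thesis unfolding closure_sequential
      using S by (intro exI[of _ "\<lambda>n. X n + Y n"]) (simp add: csubspace_def tendsto_add)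
  qed
  ultimately show ?thesis
    using closure_subset[of S] S by (auto simp: csubspace_def)
qed

lemma csubspace_projection:
  assumes S: "csubspace S" "closed S"
  obtains g where "g \<in> S" "f - g \<in> ortho_compl S"
proof -
  obtain g where g: "g \<in> S" "\<And>h. h \<in> S \<Longrightarrow> inner (f - g) h = 0"
    using subspace_projection[OF csubspace_imp_subspace[OF S(1)] S(2)] by metis
  have "cinner (f - g) h = 0" if h: "h \<in> S" for h
  proof (rule complex_eqI)
    show "Re (cinner (f - g) h) = Re 0"
      using g(2)[OF h] by (simp add: inner_L2_bGamma_def)
    \<comment> \<open>The real projection only kills real parts. Since S is complex, it may be
      tested with i h as well, and the real part of that pairing is the imaginary part of the
      pairing with h.\<close>
    have "\<i> *\<^sub>C h \<in> S" using S(1) h by (simp add: csubspace_def)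
    from g(2)[OF this] show "Im (cinner (f - g) h) = Im 0"
      by (simp add: inner_L2_bGamma_def cinner_scale_right)
  qed
  then show thesis using g(1) that by (simp add: ortho_compl_def)
qed

text \<open>The residual of f after projection onto the closure of S is orthogonal to S, hence
  zero.\<close>

lemma dense_if_ortho_compl_trivial:
  assumes S: "csubspace S" and triv: "\<And>g. g \<in> ortho_compl S \<Longrightarrow> g = 0" and e: "e > 0"
  obtains g where "g \<in> S" "norm (f - g) < e"
proof -
  obtain g where g: "g \<in> closure S" "f - g \<in> ortho_compl (closure S)"
    using csubspace_projection[OF csubspace_closure[OF S]] by auto
  moreover have "f - g \<in> ortho_compl S"
    using g(2) closure_subset[of S] by (auto simp: ortho_compl_def)
  ultimately have "f \<in> closure S" using triv by force
  then show thesis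
    using that e unfolding closure_approachable by (metis dist_commute dist_norm)
qed

lemma ortho_proj_eqI:
  assumes "csubspace S" "g \<in> S" "f - g \<in> ortho_compl S"
  shows "ortho_proj S f = g"
  unfolding ortho_proj_def
proof (rule the_equality)
  fix h assume h: "h \<in> S \<and> f - h \<in> ortho_compl S"
  then have "g - h \<in> S" using assms csubspace_diff by blast
  then have "cinner (f - h) (g - h) = 0" "cinner (f - g) (g - h) = 0"
    using h assms(3) by (auto simp: ortho_compl_def)
  then have "cinner (g - h) (g - h) = 0" by (simp add: cinner_diff_left)
  then show "h = g" by (simp add: cinner_self_eq_0)
qed (use assms in simp)

lemma ortho_proj_in:
  assumes "csubspace S" "closed S"
  shows "ortho_proj S f \<in> S" "f - ortho_proj S f \<in> ortho_compl S"
  using csubspace_projection[OF assms, of f] ortho_proj_eqI[OF assms(1)] by metis+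

lemma adjoint_on_eqI:
  assumes "csubspace K" "h \<in> K" "\<And>f. f \<in> K \<Longrightarrow> cinner (A f) g = cinner f h"
  shows "adjoint_on K A g = h"
  unfolding adjoint_on_def
proof (rule the_equality)
  fix k assume k: "k \<in> K \<and> (\<forall>f\<in>K. cinner (A f) g = cinner f k)"
  then have "k - h \<in> K" using assms csubspace_diff by blast
  then have "cinner (k - h) (k - h) = 0"
    using k assms(3) by (simp add: cinner_diff_right)
  then show "k = h" by (simp add: cinner_self_eq_0)
qed (use assms in auto)

section \<open>Multiplication operators\<close>

lemma Linf_const [simp]: "(\<lambda>_. c) \<in> Linf_bGamma"
  by (auto simp: Linf_bGamma_def)

lemma Linf_add [simp]:
  assumes "\<phi> \<in> Linf_bGamma" "\<psi> \<in> Linf_bGamma"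
  shows "(\<lambda>x. \<phi> x + \<psi> x) \<in> Linf_bGamma"
proof -
  obtain a b where [measurable]: "\<phi> \<in> borel_measurable nu" "\<psi> \<in> borel_measurable nu"
    and ab: "AE x in nu. cmod (\<phi> x) \<le> a" "AE x in nu. cmod (\<psi> x) \<le> b"
    using assms by (auto simp: Linf_bGamma_def)
  from ab have "AE x in nu. cmod (\<phi> x + \<psi> x) \<le> a + b"
    by eventually_elim (rule norm_triangle_mono)
  then show ?thesis by (auto simp: Linf_bGamma_def)
qed

lemma Linf_mult [simp]:
  assumes "\<phi> \<in> Linf_bGamma" "\<psi> \<in> Linf_bGamma"
  shows "(\<lambda>x. \<phi> x * \<psi> x) \<in> Linf_bGamma"
proof -
  obtain a b where [measurable]: "\<phi> \<in> borel_measurable nu" "\<psi> \<in> borel_measurable nu"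
    and ab: "AE x in nu. cmod (\<phi> x) \<le> a" "AE x in nu. cmod (\<psi> x) \<le> b"
    using assms by (auto simp: Linf_bGamma_def)
  from ab have "AE x in nu. cmod (\<phi> x * \<psi> x) \<le> a * b"
  proof eventually_elim
    case (elim x)
    then have "cmod (\<phi> x) * cmod (\<psi> x) \<le> a * b"
      using norm_ge_zero order_trans by (intro mult_mono) blast+
    then show ?case by (simp add: norm_mult)
  qed
  then show ?thesis by (auto simp: Linf_bGamma_def)
qed

lemma Linf_cnj [simp]: "\<phi> \<in> Linf_bGamma \<Longrightarrow> (\<lambda>x. cnj (\<phi> x)) \<in> Linf_bGamma"
  by (auto simp: Linf_bGamma_def)

text \<open>Valid for every \<open>\<phi>\<close>, because outside \<open>Linf_bGamma\<close> the
  operator is zero by definition.\<close>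

lemma mult_op_add: "mult_op \<phi> (f + g) = mult_op \<phi> f + mult_op \<phi> g"
proof (transfer, goal_cases)
  case (1 \<phi> f g)
  then show ?case
    using mult_op.rsp[THEN rel_funD, OF refl, THEN rel_funD, of "\<lambda>x. f x + g x" "\<lambda>x. f x + g x" \<phi>]
    by (auto simp: L2_rel_def sq_int_add distrib_left sq_int_zero split: if_splits)
qed

lemma mult_op_cscale: "mult_op \<phi> (c *\<^sub>C f) = c *\<^sub>C mult_op \<phi> f"
proof (transfer, goal_cases)
  case (1 \<phi> c f)
  then show ?case
    using mult_op.rsp[THEN rel_funD, OF refl, THEN rel_funD, of "\<lambda>x. c * f x" "\<lambda>x. c * f x" \<phi>]
    by (auto simp: L2_rel_def sq_int_cmult sq_int_zero mult.left_commute split: if_splits)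
qed

lemma mult_op_diff: "mult_op \<phi> (f - g) = mult_op \<phi> f - mult_op \<phi> g"
  using mult_op_add[of \<phi> "f - g" g] by simp

lemma sq_int_mult_Linf: "\<phi> \<in> Linf_bGamma \<Longrightarrow> sq_int f \<Longrightarrow> sq_int (\<lambda>x. \<phi> x * f x)"
  by (auto simp: Linf_bGamma_def intro: sq_int_bounded_mult)

lemma mult_op_abs:
  "\<phi> \<in> Linf_bGamma \<Longrightarrow> sq_int f \<Longrightarrow> mult_op \<phi> (abs_L2_bGamma f) = abs_L2_bGamma (\<lambda>x. \<phi> x * f x)"
  by (simp add: mult_op.abs_eq L2_rel_refl_iff)

lemma abs_L2_eqI:
  "sq_int f \<Longrightarrow> sq_int g \<Longrightarrow> (AE x in nu. f x = g x) \<Longrightarrow> abs_L2_bGamma f = abs_L2_bGamma g"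
  using Quotient_rel_abs[OF Quotient_L2_bGamma, of f g] by (simp add: L2_rel_def)

lemma mult_op_mult_op:
  assumes "\<phi> \<in> Linf_bGamma" "\<psi> \<in> Linf_bGamma"
  shows "mult_op \<phi> (mult_op \<psi> f) = mult_op (\<lambda>x. \<phi> x * \<psi> x) f"
  by (cases f rule: L2_bGamma_cases) (simp add: mult_op_abs assms sq_int_mult_Linf mult.assoc)

lemma mult_op_sum_symbol:
  assumes "\<phi> \<in> Linf_bGamma" "\<psi> \<in> Linf_bGamma"
  shows "mult_op (\<lambda>x. \<phi> x + \<psi> x) f = mult_op \<phi> f + mult_op \<psi> f"
  by (cases f rule: L2_bGamma_cases)
    (simp add: mult_op_abs assms sq_int_mult_Linf plus_L2_bGamma.abs_eq L2_rel_refl_iff distrib_right)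

lemma mult_op_const: "mult_op (\<lambda>_. c) f = c *\<^sub>C f"
  by (cases f rule: L2_bGamma_cases) (simp add: mult_op_abs cscale.abs_eq L2_rel_refl_iff)

lemma mult_op_cong:
  assumes "\<phi> \<in> Linf_bGamma" "\<psi> \<in> Linf_bGamma" "\<And>x. x \<in> bGamma \<Longrightarrow> \<phi> x = \<psi> x"
  shows "mult_op \<phi> f = mult_op \<psi> f"
  by (cases f rule: L2_bGamma_cases)
    (auto simp: mult_op_abs assms sq_int_mult_Linf space_nu intro!: abs_L2_eqI AE_I2)

lemma cinner_mult_op:
  assumes "\<phi> \<in> Linf_bGamma"
  shows "cinner (mult_op \<phi> f) g = cinner f (mult_op (\<lambda>x. cnj (\<phi> x)) g)"
  by (cases f rule: L2_bGamma_cases; cases g rule: L2_bGamma_cases)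
    (simp add: mult_op_abs assms sq_int_mult_Linf cinner.abs_eq L2_rel_refl_iff,
      simp add: mult_ac)

lemma norm_mult_op_le:
  assumes \<phi>: "\<phi> \<in> borel_measurable nu" and C: "AE x in nu. cmod (\<phi> x) \<le> C"
  shows "norm (mult_op \<phi> f) \<le> \<bar>C\<bar> * norm f"
proof (cases f rule: L2_bGamma_cases)
  case (abs h)
  have L: "\<phi> \<in> Linf_bGamma" using assms by (auto simp: Linf_bGamma_def)
  have "(norm (mult_op \<phi> f))\<^sup>2 = (LINT x|nu. (cmod (\<phi> x * h x))\<^sup>2) / 2"
    by (simp add: abs mult_op_abs L norm_abs_L2 sq_int_mult_Linf)
  also have "(LINT x|nu. (cmod (\<phi> x * h x))\<^sup>2) \<le> (LINT x|nu. C\<^sup>2 * (cmod (h x))\<^sup>2)"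
  proof (rule integral_mono_AE)
    show "integrable nu (\<lambda>x. (cmod (\<phi> x * h x))\<^sup>2)" "integrable nu (\<lambda>x. C\<^sup>2 * (cmod (h x))\<^sup>2)"
      using sq_int_mult_Linf[OF L abs(1)] abs(1) by (auto simp: sq_int_def)
    show "AE x in nu. (cmod (\<phi> x * h x))\<^sup>2 \<le> C\<^sup>2 * (cmod (h x))\<^sup>2"
      using C by eventually_elim (auto simp: norm_mult power_mult_distrib intro!: mult_right_mono power_mono)
  qed
  also have "(LINT x|nu. C\<^sup>2 * (cmod (h x))\<^sup>2) / 2 = (\<bar>C\<bar> * norm f)\<^sup>2"
    by (simp add: abs norm_abs_L2 power_mult_distrib)
  finally have "(norm (mult_op \<phi> f))\<^sup>2 \<le> (\<bar>C\<bar> * norm f)\<^sup>2" by simp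
  then show ?thesis by (rule power2_le_imp_le) simp
qed

section \<open>The Hardy space\<close>

lemma integral_nu:
  fixes f :: "complex \<times> complex \<Rightarrow> 'a::{banach,second_countable_topology}"
  assumes f: "f \<in> borel_measurable nu"
  shows "(LINT x|nu. f x) = (LINT z|torus_measure. (cmod (Jac z))\<^sup>2 *\<^sub>R f (symm_map z))"
    and "integrable nu f \<longleftrightarrow> integrable torus_measure (\<lambda>z. (cmod (Jac z))\<^sup>2 *\<^sub>R f (symm_map z))"
proof -
  have fr: "f \<in> borel_measurable (restrict_space borel bGamma)"
    using f measurable_cong_sets[OF sets_nu refl] by auto
  then have [measurable]: "(\<lambda>z. f (symm_map z)) \<in> borel_measurable torus_measure"
    using measurable_comp[OF symm_map_measurable] by (simp add: comp_def)
  show "(LINT x|nu. f x) = (LINT z|torus_measure. (cmod (Jac z))\<^sup>2 *\<^sub>R f (symm_map z))"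
    unfolding nu_def by (subst integral_distr[OF _ fr]) (simp_all add: integral_density)
  show "integrable nu f \<longleftrightarrow> integrable torus_measure (\<lambda>z. (cmod (Jac z))\<^sup>2 *\<^sub>R f (symm_map z))"
    unfolding nu_def by (subst integrable_distr_eq[OF _ fr]) (simp_all add: integrable_density)
qed

text \<open>Isometry of U: the factor |J|^2 from U is the density of \<open>nu\<close>, and the 2 is
  \<open>Jac_norm\<close> squared.\<close>

lemma U_map_square:
  assumes "sq_int f"
  shows "integrable torus_measure (\<lambda>z. (cmod (U_map f z))\<^sup>2)"
    and "(LINT z|torus_measure. (cmod (U_map f z))\<^sup>2) = (norm (abs_L2_bGamma f))\<^sup>2"
proof -
  have eq: "(\<lambda>z. (cmod (U_map f z))\<^sup>2) = (\<lambda>z. ((cmod (Jac z))\<^sup>2 *\<^sub>R (cmod (f (symm_map z)))\<^sup>2) / 2)"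
    by (simp add: U_map_def norm_mult norm_divide power_mult_distrib power_divide Jac_norm_square)
  have [measurable]: "f \<in> borel_measurable nu" using assms by (simp add: sq_int_def)
  show "integrable torus_measure (\<lambda>z. (cmod (U_map f z))\<^sup>2)"
    unfolding eq using assms integral_nu(2)[of "\<lambda>x. (cmod (f x))\<^sup>2"]
    by (intro integrable_divide_zero) (auto simp: sq_int_def)
  show "(LINT z|torus_measure. (cmod (U_map f z))\<^sup>2) = (norm (abs_L2_bGamma f))\<^sup>2"
    unfolding eq norm_abs_L2[OF assms] by (subst integral_nu(1)) auto
qed

lemma U_map_integrable:
  assumes "sq_int f"
  shows "integrable torus_measure (U_map f)"
  using finite_measure.integral_norm_le_square(1)[OF finite_measure_torus
      U_map_measurable U_map_square(1)[OF assms] zero_less_one] assms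
  by (simp add: sq_int_def)

lemma torus_monomial_norm:
  assumes "z \<in> space torus_measure"
  shows "cmod (cnj (fst z powi i * snd z powi j)) = 1"
  using assms by (auto simp: space_torus circle_def norm_mult norm_power_int)

lemma fourier_integrable:
  assumes "sq_int f"
  shows "integrable torus_measure (\<lambda>z. U_map f z * cnj (fst z powi i * snd z powi j))"
proof (rule Bochner_Integration.integrable_bound[OF U_map_integrable[OF assms]])
  have [measurable]: "U_map f \<in> borel_measurable torus_measure"
    using U_map_integrable[OF assms] by auto
  show "(\<lambda>z. U_map f z * cnj (fst z powi i * snd z powi j)) \<in> borel_measurable torus_measure"
    by measurable
  show "AE z in torus_measure. norm (U_map f z * cnj (fst z powi i * snd z powi j)) \<le> norm (U_map f z)"
    by (intro AE_I2) (simp only: norm_mult[of "U_map f _"] torus_monomial_norm)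
qed

lemma fourier_U_abs: "sq_int f \<Longrightarrow> fourier_U (abs_L2_bGamma f) i j = fourier_coeff (U_map f) i j"
  by (simp add: fourier_U.abs_eq L2_rel_refl_iff)

lemma fourier_U_add: "fourier_U (f + g) i j = fourier_U f i j + fourier_U g i j"
proof (cases f rule: L2_bGamma_cases; cases g rule: L2_bGamma_cases)
  fix a b assume ab: "sq_int a" "f = abs_L2_bGamma a" "sq_int b" "g = abs_L2_bGamma b"
  have "f + g = abs_L2_bGamma (\<lambda>x. a x + b x)"
    using ab by (simp add: plus_L2_bGamma.abs_eq L2_rel_refl_iff)
  then show ?thesis
    using ab fourier_integrable[OF ab(1), of i j] fourier_integrable[OF ab(3), of i j]
    by (simp add: fourier_U_abs sq_int_add fourier_coeff_def U_map_def distrib_left distrib_right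
        add_divide_distrib)
qed

lemma fourier_U_cscale: "fourier_U (c *\<^sub>C f) i j = c * fourier_U f i j"
proof (cases f rule: L2_bGamma_cases)
  case (abs a)
  then have "fourier_U (c *\<^sub>C f) i j = fourier_coeff (\<lambda>z. c * U_map a z) i j"
    by (simp add: cscale.abs_eq L2_rel_refl_iff fourier_U_abs sq_int_cmult U_map_def mult.left_commute)
  then show ?thesis using abs by (simp add: fourier_coeff_def fourier_U_abs mult.assoc)
qed

lemma fourier_U_bound: "cmod (fourier_U f i j) \<le> norm f"
proof (cases "f = 0")
  case True
  then show ?thesis using fourier_U_cscale[of 0 f i j] by (simp add: cscale_zero)
next
  case False
  obtain a where a: "sq_int a" "f = abs_L2_bGamma a" by (cases f rule: L2_bGamma_cases)
  interpret finite_measure torus_measure by (rule finite_measure_torus)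
  have "cmod (fourier_U f i j)
      \<le> (LINT z|torus_measure. cmod (U_map a z * cnj (fst z powi i * snd z powi j)))"
    using a by (simp add: fourier_U_abs fourier_coeff_def integral_norm_bound)
  also have "\<dots> = (LINT z|torus_measure. cmod (U_map a z))"
    by (intro Bochner_Integration.integral_cong refl)
      (simp only: norm_mult[of "U_map a _"] torus_monomial_norm)
  \<comment> \<open>With t = \<open>norm f\<close> and total mass 1 the two terms are equal and
    average to \<open>norm f\<close>; the choice requires f nonzero, hence the case split.\<close>
  also have "\<dots> \<le> (norm f * measure torus_measure (space torus_measure)
      + (LINT z|torus_measure. (cmod (U_map a z))\<^sup>2) / norm f) / 2"
    using False U_map_integrable[OF a(1)] U_map_square(1)[OF a(1)]
    by (intro integral_norm_le_square(2)) auto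
  also have "\<dots> = norm f"
    unfolding U_map_square(2)[OF a(1)] a(2)[symmetric]
    using False by (simp add: measure_def emeasure_torus_space power2_eq_square)
  finally show ?thesis .
qed

lemma bounded_linear_fourier_U: "bounded_linear (\<lambda>f. fourier_U f i j)"
  by (rule bounded_linear_intro[where K = 1])
    (auto simp: fourier_U_add scaleR_L2_bGamma_def fourier_U_cscale scaleR_conv_of_real fourier_U_bound)

lemma H2_iff: "f \<in> H2 \<longleftrightarrow> (\<forall>i j. i < 0 \<or> j < 0 \<longrightarrow> fourier_U f i j = 0)"
  by (auto simp: H2_def not_le) (meson linorder_not_less)+

lemma csubspace_H2: "csubspace H2"
  using fourier_U_cscale[of 0 0]
  by (auto simp: csubspace_def H2_iff fourier_U_add fourier_U_cscale cscale_zero)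

lemma closed_H2: "closed H2"
proof -
  have "H2 = (\<Inter>i. \<Inter>j. {f. i < 0 \<or> j < 0 \<longrightarrow> fourier_U f i j = 0})"
    by (auto simp: H2_iff)
  moreover have "closed {f. i < 0 \<or> j < 0 \<longrightarrow> fourier_U f i j = 0}" for i j
    by (cases "i < 0 \<or> j < 0")
      (auto intro!: closed_Collect_eq linear_continuous_on bounded_linear_fourier_U)
  then have "closed (\<Inter>i. \<Inter>j. {f. i < 0 \<or> j < 0 \<longrightarrow> fourier_U f i j = 0})"
    by (intro closed_INT ballI)
  ultimately show ?thesis by (simp only:)
qed

lemma fst_in_Linf [simp]: "fst \<in> Linf_bGamma"
  using Linf_cnj[OF sbar_in_Linf] by (simp add: sbar_def case_prod_beta)

lemma snd_in_Linf [simp]: "snd \<in> Linf_bGamma"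
  using Linf_cnj[OF pbar_in_Linf] by (simp add: pbar_def case_prod_beta)

lemma circle_mult_cnj: "z \<in> circle \<Longrightarrow> z * cnj z = 1"
  by (simp add: circle_def complex_norm_square[symmetric])

lemma circle_powi_shift:
  assumes "z \<in> circle"
  shows "z * cnj (z powi i) = cnj (z powi (i - 1))"
proof -
  have "z \<noteq> 0" using assms by (auto simp: circle_def)
  then have "z powi i = z powi (i - 1) * z"
    using power_int_add_1[of z "i - 1"] by simp
  then show ?thesis using circle_mult_cnj[OF assms] by (simp add: mult.left_commute)
qed

lemma torusD: "z \<in> space torus_measure \<Longrightarrow> fst z \<in> circle \<and> snd z \<in> circle"
  by (auto simp: space_torus)

text \<open>On the torus p pulls back to z1 z2, and a unimodular factor z1 or z2 lowers the
  corresponding index of the coefficient by one. For s the pullback z1 + z2 gives the sum of the two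
  one-variable shifts.\<close>

lemma fourier_U_mult_snd: "fourier_U (mult_op snd f) i j = fourier_U f (i - 1) (j - 1)"
proof (cases f rule: L2_bGamma_cases)
  case (abs a)
  have "fourier_coeff (U_map (\<lambda>x. snd x * a x)) i j = fourier_coeff (U_map a) (i - 1) (j - 1)"
    unfolding fourier_coeff_def
  proof (intro Bochner_Integration.integral_cong refl)
    fix z assume z: "z \<in> space torus_measure"
    have "U_map (\<lambda>x. snd x * a x) z * cnj (fst z powi i * snd z powi j)
        = U_map a z * ((fst z * cnj (fst z powi i)) * (snd z * cnj (snd z powi j)))"
      by (simp add: U_map_def symm_map_def case_prod_beta)
    then show "U_map (\<lambda>x. snd x * a x) z * cnj (fst z powi i * snd z powi j)
        = U_map a z * cnj (fst z powi (i - 1) * snd z powi (j - 1))"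
      using torusD[OF z] by (simp only: circle_powi_shift complex_cnj_mult)
  qed
  then show ?thesis by (simp add: abs mult_op_abs fourier_U_abs sq_int_mult_Linf)
qed

lemma fourier_U_mult_fst:
  "fourier_U (mult_op fst f) i j = fourier_U f (i - 1) j + fourier_U f i (j - 1)"
proof (cases f rule: L2_bGamma_cases)
  case (abs a)
  have "fourier_coeff (U_map (\<lambda>x. fst x * a x)) i j
      = (LINT z|torus_measure. U_map a z * cnj (fst z powi (i - 1) * snd z powi j)
          + U_map a z * cnj (fst z powi i * snd z powi (j - 1)))"
    unfolding fourier_coeff_def
  proof (intro Bochner_Integration.integral_cong refl)
    fix z assume z: "z \<in> space torus_measure"
    have "U_map (\<lambda>x. fst x * a x) z * cnj (fst z powi i * snd z powi j)
        = U_map a z * ((fst z * cnj (fst z powi i)) * cnj (snd z powi j)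
            + cnj (fst z powi i) * (snd z * cnj (snd z powi j)))"
      by (simp add: U_map_def symm_map_def case_prod_beta algebra_simps add_divide_distrib)
    also have "\<dots> = U_map a z * (cnj (fst z powi (i - 1)) * cnj (snd z powi j)
            + cnj (fst z powi i) * cnj (snd z powi (j - 1)))"
      using torusD[OF z] by (simp only: circle_powi_shift)
    finally show "U_map (\<lambda>x. fst x * a x) z * cnj (fst z powi i * snd z powi j)
        = U_map a z * cnj (fst z powi (i - 1) * snd z powi j)
          + U_map a z * cnj (fst z powi i * snd z powi (j - 1))"
      by (simp only: complex_cnj_mult distrib_left)
  qed
  also have "\<dots> = fourier_coeff (U_map a) (i - 1) j + fourier_coeff (U_map a) i (j - 1)"
    unfolding fourier_coeff_def
    by (rule Bochner_Integration.integral_add) (rule fourier_integrable[OF abs(1)])+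
  finally show ?thesis by (simp add: abs mult_op_abs fourier_U_abs sq_int_mult_Linf)
qed

text \<open>A negative index stays negative when lowered, so the vanishing conditions that define
  \<open>H2\<close> survive multiplication by p, and likewise by s.\<close>

lemma H2_mult_snd: "f \<in> H2 \<Longrightarrow> mult_op snd f \<in> H2"
  by (simp add: H2_iff fourier_U_mult_snd)

lemma H2_mult_fst: "f \<in> H2 \<Longrightarrow> mult_op fst f \<in> H2"
  by (auto simp: H2_iff fourier_U_mult_fst)

definition L2_one :: L2_bGamma where
  "L2_one = abs_L2_bGamma (\<lambda>_. 1)"

lemma sq_int_const [simp]: "sq_int (\<lambda>_. c)"
  using finite_measure_nu by (simp add: sq_int_def finite_measure.integrable_const)

lemma mult_op_one: "\<phi> \<in> Linf_bGamma \<Longrightarrow> mult_op \<phi> L2_one = abs_L2_bGamma \<phi>"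
  by (simp add: L2_one_def mult_op_abs)

lemma Linf_sq_int: "\<phi> \<in> Linf_bGamma \<Longrightarrow> sq_int \<phi>"
  using sq_int_mult_Linf[of \<phi> "\<lambda>_. 1"] by simp

text \<open>On the torus \<open>cnj (z - w) * (z * w) = w - z\<close>, so pairing with \<open>pbar\<close> reads off the Fourier
  coefficients at \<open>(0, -1)\<close> and \<open>(-1, 0)\<close>.\<close>

lemma pbar_in_H2_perp: "mult_op pbar L2_one \<in> H2_perp"
proof -
  have "cinner f (mult_op pbar L2_one) = 0" if f: "f \<in> H2" for f
  proof (cases f rule: L2_bGamma_cases)
    case (abs a)
    have [measurable]: "a \<in> borel_measurable nu" using abs(1) by (simp add: sq_int_def)
    have [measurable]: "pbar \<in> borel_measurable nu" using pbar_in_Linf by (simp add: Linf_bGamma_def)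
    have "(LINT x|nu. a x * cnj (pbar x))
        = (LINT z|torus_measure. complex_of_real Jac_norm *
            (U_map a z * cnj (fst z powi 0 * snd z powi -1) - U_map a z * cnj (fst z powi -1 * snd z powi 0)))"
    proof (subst integral_nu(1), measurable, intro Bochner_Integration.integral_cong refl)
      fix z assume "z \<in> space torus_measure"
      then have z: "fst z \<in> circle" "snd z \<in> circle" using torusD by auto
      then have nz: "fst z \<noteq> 0" "snd z \<noteq> 0" by (auto simp: circle_def)
      from z have "cnj (fst z) = inverse (fst z)" "cnj (snd z) = inverse (snd z)"
        using inverse_unique circle_mult_cnj by metis+
      note zw = this nz
      have J: "complex_of_real ((cmod (Jac z))\<^sup>2) * (fst z * snd z) = Jac z * (snd z - fst z)"
        using zw unfolding complex_norm_square
        by (simp add: Jac_def case_prod_beta field_simps)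
      have "(cmod (Jac z))\<^sup>2 *\<^sub>R (a (symm_map z) * cnj (pbar (symm_map z)))
          = complex_of_real ((cmod (Jac z))\<^sup>2) * (fst z * snd z) * a (symm_map z)"
        by (simp add: scaleR_conv_of_real pbar_def symm_map_def case_prod_beta mult_ac)
      also have "\<dots> = complex_of_real Jac_norm * (U_map a z * (snd z - fst z))"
        using Jac_norm_pos by (simp only: J) (simp add: U_map_def)
      also have "snd z - fst z = cnj (fst z powi 0 * snd z powi -1) - cnj (fst z powi -1 * snd z powi 0)"
        using zw by simp
      finally show "(cmod (Jac z))\<^sup>2 *\<^sub>R (a (symm_map z) * cnj (pbar (symm_map z)))
          = complex_of_real Jac_norm *
            (U_map a z * cnj (fst z powi 0 * snd z powi -1) - U_map a z * cnj (fst z powi -1 * snd z powi 0))"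
        by (simp only: right_diff_distrib)
    qed
    also have "\<dots> = complex_of_real Jac_norm * (fourier_U f 0 (-1) - fourier_U f (-1) 0)"
      unfolding abs(2) fourier_U_abs[OF abs(1)] fourier_coeff_def integral_mult_right_zero
      by (subst Bochner_Integration.integral_diff
          [OF fourier_integrable[OF abs(1)] fourier_integrable[OF abs(1)]]) (rule refl)
    also have "\<dots> = 0" using f by (simp add: H2_iff)
    finally show ?thesis
      by (simp add: abs mult_op_one pbar_in_Linf cinner.abs_eq L2_rel_refl_iff Linf_sq_int)
  qed
  then show ?thesis
    unfolding ortho_compl_def by (simp add: cinner_eq_0_commute)
qed

section \<open>Density of the polynomials\<close>

text \<open>A property of symbols that survives sums, products and constants need only be checked on
  s, p and their conjugates. It is used for membership in \<open>Linf_bGamma\<close> and for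
  compatibility with \<open>represents\<close>.\<close>

lemma real_polynomial_in_star_algebra:
  fixes \<A> :: "(complex \<times> complex \<Rightarrow> complex) set"
  assumes const: "\<And>c. (\<lambda>_. c) \<in> \<A>"
    and add: "\<And>f g. f \<in> \<A> \<Longrightarrow> g \<in> \<A> \<Longrightarrow> (\<lambda>x. f x + g x) \<in> \<A>"
    and mult: "\<And>f g. f \<in> \<A> \<Longrightarrow> g \<in> \<A> \<Longrightarrow> (\<lambda>x. f x * g x) \<in> \<A>"
    and gens: "fst \<in> \<A>" "snd \<in> \<A>" "(\<lambda>x. cnj (fst x)) \<in> \<A>" "(\<lambda>x. cnj (snd x)) \<in> \<A>"
    and q: "real_polynomial_function q"
  shows "(\<lambda>x. complex_of_real (q x)) \<in> \<A>"
  using q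
proof induction
  case (linear l)
  have scale: "(\<lambda>x. c * f x) \<in> \<A>" if "f \<in> \<A>" for c f using mult[OF const that] .
  \<comment> \<open>A real functional on C^2 is determined by its values on the real basis (1,0),
    (i,0), (0,1), (0,i).\<close>
  have l: "l x = Re (fst x) * l (1, 0) + Im (fst x) * l (\<i>, 0) + Re (snd x) * l (0, 1)
      + Im (snd x) * l (0, \<i>)" for x
  proof -
    interpret bounded_linear l by (rule linear)
    have "x = Re (fst x) *\<^sub>R (1, 0) + Im (fst x) *\<^sub>R (\<i>, 0) + Re (snd x) *\<^sub>R (0, 1)
      + Im (snd x) *\<^sub>R (0, \<i>)"
      by (auto simp: prod_eq_iff complex_eq_iff)
    then have "l x = l (Re (fst x) *\<^sub>R (1, 0) + Im (fst x) *\<^sub>R (\<i>, 0) + Re (snd x) *\<^sub>R (0, 1)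
      + Im (snd x) *\<^sub>R (0, \<i>))" by simp
    then show ?thesis by (simp only: add scaleR real_scaleR_def)
  qed
  \<comment> \<open>Differences are written as sums with a factor -1, so that the closure rules for
    sums and constant multiples apply directly.\<close>
  have Re_Im: "complex_of_real (Re z) = 1/2 * (z + cnj z)"
    "complex_of_real (Im z) = (- \<i>/2) * (z + - 1 * cnj z)" for z
    by (simp_all add: complex_eq_iff)
  have "(\<lambda>x. complex_of_real (l (1, 0)) * (1/2 * (fst x + cnj (fst x)))
      + complex_of_real (l (\<i>, 0)) * ((- \<i>/2) * (fst x + - 1 * cnj (fst x)))
      + complex_of_real (l (0, 1)) * (1/2 * (snd x + cnj (snd x)))
      + complex_of_real (l (0, \<i>)) * ((- \<i>/2) * (snd x + - 1 * cnj (snd x)))) \<in> \<A>"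
    by (intro add scale gens)
  then show ?case
    unfolding Re_Im[symmetric] by (subst l) (simp add: mult.commute)
next
  case (const c)
  then show ?case by (rule assms(1))
next
  case (add f g)
  then show ?case using assms(2) by simp
next
  case (mult f g)
  then show ?case using assms(3) by simp
qed

lemma compact_bGamma: "compact bGamma"
  unfolding bGamma_def symm_map_def case_prod_beta circle_def
  by (intro compact_continuous_image continuous_intros compact_Times compact_sphere)

lemma polynomial_in_Linf:
  assumes "real_polynomial_function q"
  shows "(\<lambda>x. complex_of_real (q x)) \<in> Linf_bGamma"
proof (rule real_polynomial_in_star_algebra[OF _ _ _ _ _ _ _ assms])
  show "(\<lambda>x. cnj (fst x)) \<in> Linf_bGamma" "(\<lambda>x. cnj (snd x)) \<in> Linf_bGamma" by simp_all
qed simp_all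

text \<open>The test above is for Borel measures on the whole Euclidean space, while the space of
  \<open>nu\<close> is \<open>bGamma\<close>. Pushing \<open>nu\<close> forward along the inclusion
  and extending g by zero bridges the gap.\<close>

lemma nu_AE_nonneg:
  fixes g :: "complex \<times> complex \<Rightarrow> real"
  assumes g: "integrable nu g"
    and nonneg: "\<And>q. real_polynomial_function q \<Longrightarrow> 0 \<le> (LINT x|nu. (q x)\<^sup>2 * g x)"
  shows "AE x in nu. 0 \<le> g x"
proof -
  have sets_bG: "bGamma \<in> sets borel" using compact_bGamma by (simp add: borel_compact)
  define N where "N = distr nu borel (\<lambda>x. x)"
  have id: "(\<lambda>x. x) \<in> measurable nu borel"
    unfolding measurable_cong_sets[OF sets_nu refl] by (intro measurable_restrict_space1) simp
  define g' where "g' x = indicator bGamma x * g x" for x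
  have "g \<in> borel_measurable (restrict_space borel bGamma)"
    using g measurable_cong_sets[OF sets_nu refl] by auto
  then have [measurable]: "g' \<in> borel_measurable borel"
    unfolding g'_def using sets_bG by (subst (asm) borel_measurable_restrict_space_iff) auto
  have g': "g' x = g x" if "x \<in> space nu" for x using that by (simp add: g'_def space_nu)
  have "AE x in N. 0 \<le> g' x"
  proof (rule AE_nonneg_if_squares_nonneg[OF _ _ compact_bGamma])
    interpret nu: finite_measure nu by (rule finite_measure_nu)
    show "finite_measure N" unfolding N_def by (rule nu.finite_measure_distr[OF id])
    show "sets N = sets borel" by (simp add: N_def)
    show "AE x in N. x \<in> bGamma"
      unfolding N_def using sets_bG by (subst AE_distr_iff[OF id]) (auto simp: space_nu[symmetric])
    show "integrable N g'"
      unfolding N_def using g by (subst integrable_distr_eq[OF id]) (auto simp: g' cong: Bochner_Integration.integrable_cong)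
    fix q :: "complex \<times> complex \<Rightarrow> real" assume q: "real_polynomial_function q"
    then have "continuous_on UNIV q"
      by (simp add: continuous_on_polymonial_function real_polynomial_function_eq)
    then have [measurable]: "q \<in> borel_measurable borel" by (rule borel_measurable_continuous_onI)
    have "(LINT x|N. (q x)\<^sup>2 * g' x) = (LINT x|nu. (q x)\<^sup>2 * g' x)"
      unfolding N_def by (rule integral_distr[OF id]) measurable
    also have "\<dots> = (LINT x|nu. (q x)\<^sup>2 * g x)"
      by (intro Bochner_Integration.integral_cong) (auto simp: g')
    finally show "0 \<le> (LINT x|N. (q x)\<^sup>2 * g' x)" using nonneg[OF q] by simp
  qed
  then have "AE x in nu. 0 \<le> g' x" unfolding N_def by (subst (asm) AE_distr_iff[OF id]) auto
  then show ?thesis using g' by (auto elim: AE_mp intro!: AE_I2)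
qed

text \<open>Squares of polynomials are polynomials, so the nonnegativity test applies to both g and
  -g.\<close>

lemma nu_AE_zero:
  fixes g :: "complex \<times> complex \<Rightarrow> real"
  assumes g: "integrable nu g"
    and zero: "\<And>q. real_polynomial_function q \<Longrightarrow> (LINT x|nu. q x * g x) = 0"
  shows "AE x in nu. g x = 0"
proof -
  have sq: "(LINT x|nu. (q x)\<^sup>2 * g x) = 0" if "real_polynomial_function q" for q
    by (intro zero real_polynomial_function_power that)
  have "AE x in nu. 0 \<le> g x" "AE x in nu. 0 \<le> - g x"
    using g by (intro nu_AE_nonneg; simp add: sq)+
  then show ?thesis by eventually_elim simp
qed

lemma sq_int_integrable: "sq_int f \<Longrightarrow> integrable nu f"
  using sq_int_prod_integrable[of f "\<lambda>_. 1"] by simp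

lemma orthogonal_polynomials_imp_zero:
  assumes "\<And>q. real_polynomial_function q \<Longrightarrow> cinner f (mult_op (\<lambda>x. complex_of_real (q x)) L2_one) = 0"
  shows "f = 0"
proof (cases f rule: L2_bGamma_cases)
  case (abs a)
  have int: "integrable nu (\<lambda>x. a x * complex_of_real (q x))"
    and zero: "(LINT x|nu. a x * complex_of_real (q x)) = 0" if q: "real_polynomial_function q" for q
  proof -
    note L = polynomial_in_Linf[OF q]
    show "integrable nu (\<lambda>x. a x * complex_of_real (q x))"
      using sq_int_prod_integrable[OF abs(1) Linf_sq_int[OF L]] by simp
    show "(LINT x|nu. a x * complex_of_real (q x)) = 0"
      using assms[OF q] Jac_norm_pos abs Linf_sq_int[OF L]
      by (simp add: mult_op_one[OF L] cinner.abs_eq L2_rel_refl_iff)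
  qed
  have a: "integrable nu a" using abs(1) by (rule sq_int_integrable)
  have "(LINT x|nu. q x * Re (a x)) = 0" if q: "real_polynomial_function q" for q
    using integral_Re[OF int[OF q]] zero[OF q] by (simp add: mult.commute)
  then have "AE x in nu. Re (a x) = 0" using a by (intro nu_AE_zero) auto
  moreover have "(LINT x|nu. q x * Im (a x)) = 0" if q: "real_polynomial_function q" for q
    using integral_Im[OF int[OF q]] zero[OF q] by (simp add: mult.commute)
  then have "AE x in nu. Im (a x) = 0" using a by (intro nu_AE_zero) auto
  ultimately have "AE x in nu. a x = 0" by eventually_elim (simp add: complex_eq_iff)
  then show "f = 0"
    unfolding abs(2) zero_L2_bGamma.abs_eq using abs(1) by (intro abs_L2_eqI) auto
qed

lemma csubspace_polynomials_dense:
  assumes "csubspace L" "e > 0"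
    and "\<And>q. real_polynomial_function q \<Longrightarrow> mult_op (\<lambda>x. complex_of_real (q x)) L2_one \<in> L"
  obtains g where "g \<in> L" "norm (f - g) < e"
proof (rule dense_if_ortho_compl_trivial[OF assms(1) _ assms(2)])
  show "g = 0" if "g \<in> ortho_compl L" for g
    using that assms(3) by (intro orthogonal_polynomials_imp_zero) (auto simp: ortho_compl_def)
qed (use that in auto)

text \<open>Squared, the norm inequality says that q^2 (C^2 - |phi|^2) has nonnegative integral,
  which is what the test with squares asks for. Only square integrability of \<open>\<phi>\<close>
  is assumed, and boundedness comes out.\<close>

lemma AE_bounded_if_polynomials_bounded:
  assumes \<phi>: "sq_int \<phi>" and C: "C \<ge> 0"
    and le: "\<And>q. real_polynomial_function q \<Longrightarrow>
      norm (mult_op (\<lambda>x. complex_of_real (q x)) (abs_L2_bGamma \<phi>))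
        \<le> C * norm (mult_op (\<lambda>x. complex_of_real (q x)) L2_one)"
  shows "AE x in nu. cmod (\<phi> x) \<le> C"
proof -
  have int\<phi>: "integrable nu (\<lambda>x. (cmod (\<phi> x))\<^sup>2)" using \<phi> by (simp add: sq_int_def)
  interpret nu: finite_measure nu by (rule finite_measure_nu)
  have "AE x in nu. 0 \<le> C\<^sup>2 - (cmod (\<phi> x))\<^sup>2"
  proof (rule nu_AE_nonneg)
    show "integrable nu (\<lambda>x. C\<^sup>2 - (cmod (\<phi> x))\<^sup>2)" using int\<phi> by simp
    fix q :: "complex \<times> complex \<Rightarrow> real" assume q: "real_polynomial_function q"
    note L = polynomial_in_Linf[OF q]
    have sq: "sq_int (\<lambda>x. complex_of_real (q x) * \<phi> x)" "sq_int (\<lambda>x. complex_of_real (q x))"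
      using sq_int_mult_Linf[OF L \<phi>] Linf_sq_int[OF L] by auto
    have i1: "integrable nu (\<lambda>x. (q x)\<^sup>2 * (cmod (\<phi> x))\<^sup>2)"
      using sq(1) by (simp add: sq_int_def norm_mult power_mult_distrib)
    have i2: "integrable nu (\<lambda>x. C\<^sup>2 * (q x)\<^sup>2)"
      using sq(2) by (simp add: sq_int_def)
    have "(norm (mult_op (\<lambda>x. complex_of_real (q x)) (abs_L2_bGamma \<phi>)))\<^sup>2
        \<le> (C * norm (mult_op (\<lambda>x. complex_of_real (q x)) L2_one))\<^sup>2"
      by (intro power_mono le[OF q]) auto
    then have "(LINT x|nu. (q x)\<^sup>2 * (cmod (\<phi> x))\<^sup>2) \<le> C\<^sup>2 * (LINT x|nu. (q x)\<^sup>2)"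
      using sq by (simp add: mult_op_one[OF L] mult_op_abs[OF L \<phi>] power_mult_distrib norm_abs_L2 norm_mult)
    also have "\<dots> = (LINT x|nu. C\<^sup>2 * (q x)\<^sup>2)" by simp
    finally show "0 \<le> (LINT x|nu. (q x)\<^sup>2 * (C\<^sup>2 - (cmod (\<phi> x))\<^sup>2))"
      using i1 i2 by (simp add: right_diff_distrib mult.commute[of "(q _)\<^sup>2" "C\<^sup>2"])
  qed
  then show ?thesis
    by eventually_elim (use C in \<open>auto intro: power2_le_imp_le\<close>)
qed

section \<open>Dual Toeplitz operators\<close>

lemma bounded_bilinear_cinner: "bounded_bilinear cinner"
proof
  show "\<exists>K. \<forall>a b. norm (cinner a b) \<le> norm a * norm b * K"
    using cinner_Cauchy_Schwarz by (intro exI[of _ 1]) simp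
qed (simp_all add: cinner_add_left cinner_add_right scaleR_L2_bGamma_def cinner_scale_left
    cinner_scale_right scaleR_conv_of_real)

lemmas tendsto_cinner = bounded_bilinear.tendsto[OF bounded_bilinear_cinner]

lemma sbar_eq: "sbar = (\<lambda>x. cnj (fst x))" and pbar_eq: "pbar = (\<lambda>x. cnj (snd x))"
  by (auto simp: sbar_def pbar_def)

lemmas Linf_coords [simp] = sbar_in_Linf pbar_in_Linf

lemma cinner_sbar: "cinner (mult_op sbar f) g = cinner f (mult_op fst g)"
  and cinner_pbar: "cinner (mult_op pbar f) g = cinner f (mult_op snd g)"
  and cinner_fst: "cinner (mult_op fst f) g = cinner f (mult_op sbar g)"
  and cinner_snd: "cinner (mult_op snd f) g = cinner f (mult_op pbar g)"
  by (simp_all add: cinner_mult_op sbar_eq pbar_eq)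

lemma mult_op_commute:
  "\<phi> \<in> Linf_bGamma \<Longrightarrow> \<psi> \<in> Linf_bGamma \<Longrightarrow> mult_op \<phi> (mult_op \<psi> f) = mult_op \<psi> (mult_op \<phi> f)"
  by (simp add: mult_op_mult_op mult.commute)

lemma bGamma_snd_cnj: "x \<in> bGamma \<Longrightarrow> snd x * cnj (snd x) = 1"
  by (auto simp: bGamma_def symm_map_def circle_def norm_mult complex_norm_square[symmetric] simp del: complex_cnj_mult)

lemma bGamma_fst: "x \<in> bGamma \<Longrightarrow> snd x * cnj (fst x) = fst x"
proof -
  assume "x \<in> bGamma"
  then obtain z w where x: "x = (z + w, z * w)" and "z \<in> circle" "w \<in> circle"
    by (auto simp: bGamma_def symm_map_def)
  then have "z * cnj z = 1" "w * cnj w = 1" using circle_mult_cnj by auto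
  then show ?thesis unfolding x by (simp add: distrib_left) algebra
qed

lemma mult_op_snd_pbar [simp]: "mult_op snd (mult_op pbar f) = f"
  and mult_op_pbar_snd [simp]: "mult_op pbar (mult_op snd f) = f"
proof -
  have "mult_op snd (mult_op pbar f) = mult_op (\<lambda>_. 1) f"
    using mult_op_cong[of "\<lambda>x. snd x * pbar x" "\<lambda>_. 1"] by (simp add: mult_op_mult_op pbar_eq bGamma_snd_cnj)
  then show "mult_op snd (mult_op pbar f) = f" by (simp add: mult_op_const cscale_one)
  then show "mult_op pbar (mult_op snd f) = f" by (simp add: mult_op_commute[of pbar snd])
qed

lemma mult_op_snd_sbar: "mult_op snd (mult_op sbar f) = mult_op fst f"
  using mult_op_cong[of "\<lambda>x. snd x * sbar x" fst] by (simp add: mult_op_mult_op sbar_eq bGamma_fst)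

lemma mult_op_fst_pbar: "mult_op fst (mult_op pbar f) = mult_op sbar f"
  by (simp add: mult_op_snd_sbar[symmetric] mult_op_commute[of sbar pbar])

lemma norm_mult_op_pbar [simp]: "norm (mult_op pbar f) = norm f"
proof -
  have "complex_of_real ((norm (mult_op pbar f))\<^sup>2) = complex_of_real ((norm f)\<^sup>2)"
    unfolding cinner_self[symmetric] by (simp add: cinner_pbar)
  then show ?thesis by (simp add: power2_eq_iff_nonneg flip: of_real_power)
qed

text \<open>\<open>pbar\<close> and \<open>sbar\<close> act as adjoints of p and s, which preserve
  \<open>H2\<close>. Hence the dual Toeplitz operators of \<open>pbar\<close> and
  \<open>sbar\<close> are plain multiplications on \<open>H2_perp\<close>.\<close>

lemma H2_perp_pbar: "f \<in> H2_perp \<Longrightarrow> mult_op pbar f \<in> H2_perp"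
  by (simp add: ortho_compl_def cinner_pbar H2_mult_snd)

lemma H2_perp_sbar: "f \<in> H2_perp \<Longrightarrow> mult_op sbar f \<in> H2_perp"
  by (simp add: ortho_compl_def cinner_sbar H2_mult_fst)

lemma dual_toeplitz_in [simp]: "dual_toeplitz \<phi> f \<in> H2_perp"
  unfolding dual_toeplitz_def by (rule ortho_proj_in(2)[OF csubspace_H2 closed_H2])

text \<open>The projected part lies in \<open>H2\<close> and vanishes against
  \<open>H2_perp\<close>. Identities between dual Toeplitz operators can thus be checked as
  identities between multiplications.\<close>

lemma cinner_dual_toeplitz:
  assumes "g \<in> H2_perp"
  shows "cinner (dual_toeplitz \<phi> f) g = cinner (mult_op \<phi> f) g"
proof -
  have "cinner g (ortho_proj H2 (mult_op \<phi> f)) = 0"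
    using assms ortho_proj_in(1)[OF csubspace_H2 closed_H2] by (simp add: ortho_compl_def)
  then show ?thesis by (simp add: dual_toeplitz_def cinner_diff_left cinner_eq_0_commute)
qed

lemma H2_perp_eqI:
  assumes "f \<in> H2_perp" "g \<in> H2_perp" "\<And>h. h \<in> H2_perp \<Longrightarrow> cinner f h = cinner g h"
  shows "f = g"
proof -
  have "f - g \<in> H2_perp" by (rule csubspace_diff[OF csubspace_ortho_compl assms(1,2)])
  then have "cinner (f - g) (f - g) = 0" by (simp add: assms(3) cinner_diff_left[of f g])
  then show ?thesis by (simp add: cinner_self_eq_0)
qed

lemma H2_perp_eq_iff:
  "f \<in> H2_perp \<Longrightarrow> g \<in> H2_perp \<Longrightarrow> f = g \<longleftrightarrow> (\<forall>h\<in>H2_perp. cinner f h = cinner g h)"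
  using H2_perp_eqI by blast

lemma dual_toeplitz_pbar: "f \<in> H2_perp \<Longrightarrow> dual_toeplitz pbar f = mult_op pbar f"
  by (rule H2_perp_eqI) (simp_all add: H2_perp_pbar cinner_dual_toeplitz)

lemma dual_toeplitz_sbar: "f \<in> H2_perp \<Longrightarrow> dual_toeplitz sbar f = mult_op sbar f"
  by (rule H2_perp_eqI) (simp_all add: H2_perp_sbar cinner_dual_toeplitz)

lemma adjoint_dual_toeplitz:
  assumes "\<phi> \<in> Linf_bGamma" "g \<in> H2_perp"
  shows "adjoint_on H2_perp (dual_toeplitz \<phi>) g = dual_toeplitz (\<lambda>x. cnj (\<phi> x)) g"
proof (rule adjoint_on_eqI[OF csubspace_ortho_compl])
  fix f assume "f \<in> H2_perp"
  then show "cinner (dual_toeplitz \<phi> f) g = cinner f (dual_toeplitz (\<lambda>x. cnj (\<phi> x)) g)"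
    using assms cinner_commute[of f "dual_toeplitz (\<lambda>x. cnj (\<phi> x)) g"]
      cinner_commute[of f "mult_op (\<lambda>x. cnj (\<phi> x)) g"]
    by (simp add: cinner_dual_toeplitz cinner_mult_op)
qed simp

lemma adjoint_sbar: "g \<in> H2_perp \<Longrightarrow> adjoint_on H2_perp (dual_toeplitz sbar) g = dual_toeplitz fst g"
  and adjoint_pbar: "g \<in> H2_perp \<Longrightarrow> adjoint_on H2_perp (dual_toeplitz pbar) g = dual_toeplitz snd g"
  by (simp_all add: adjoint_dual_toeplitz, simp_all add: sbar_eq pbar_eq)

text \<open>Let g tend to f itself. This turns estimates of pairings with
  \<open>eventually_perp\<close>, the only ones available below, into norm bounds.\<close>

lemma norm_le_if_cinner_le_dense:
  assumes dense: "closure D = UNIV" and le: "\<And>g. g \<in> D \<Longrightarrow> cmod (cinner f g) \<le> C * norm g"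
    and C: "C \<ge> 0"
  shows "norm f \<le> C"
proof -
  have "f \<in> closure D" using dense by simp
  then obtain X where X: "\<And>n. X n \<in> D" "X \<longlonglongrightarrow> f" unfolding closure_sequential by auto
  have "cmod (cinner f f) \<le> C * norm f"
  proof (rule LIMSEQ_le)
    show "(\<lambda>n. cmod (cinner f (X n))) \<longlonglongrightarrow> cmod (cinner f f)"
      by (intro tendsto_norm tendsto_cinner tendsto_const X(2))
    show "(\<lambda>n. C * norm (X n)) \<longlonglongrightarrow> C * norm f"
      by (intro tendsto_intros X(2))
  qed (use le X(1) in blast)
  then have "norm f * norm f \<le> C * norm f"
    by (simp add: cinner_self norm_mult power2_eq_square)
  then show ?thesis using C by (cases "norm f = 0") auto
qed

section \<open>The dilation of an operator satisfying the relations\<close>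

locale brown_halmos =
  fixes T :: "L2_bGamma \<Rightarrow> L2_bGamma"
  assumes bounded_T: "bounded_op_on H2_perp T"
    and rel_s: "\<And>f g. f \<in> H2_perp \<Longrightarrow> g \<in> H2_perp \<Longrightarrow>
      cinner (T (mult_op pbar f)) (mult_op sbar g) = cinner (T (mult_op sbar f)) g"
    and rel_p: "\<And>f g. f \<in> H2_perp \<Longrightarrow> g \<in> H2_perp \<Longrightarrow>
      cinner (T (mult_op pbar f)) (mult_op pbar g) = cinner (T f) g"
begin

abbreviation shift :: "nat \<Rightarrow> L2_bGamma \<Rightarrow> L2_bGamma" where
  "shift n \<equiv> mult_op pbar ^^ n"

lemma T_in: "f \<in> H2_perp \<Longrightarrow> T f \<in> H2_perp"
  and T_add: "f \<in> H2_perp \<Longrightarrow> g \<in> H2_perp \<Longrightarrow> T (f + g) = T f + T g"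
  and T_cscale: "f \<in> H2_perp \<Longrightarrow> T (c *\<^sub>C f) = c *\<^sub>C T f"
  using bounded_T by (auto simp: bounded_op_on_def)

lemma T_bound: obtains C where "C \<ge> 0" "\<And>f. f \<in> H2_perp \<Longrightarrow> norm (T f) \<le> C * norm f"
proof -
  obtain C where C: "\<And>f. f \<in> H2_perp \<Longrightarrow> norm (T f) \<le> C * norm f"
    using bounded_T unfolding bounded_op_on_def by blast
  have "norm (T f) \<le> \<bar>C\<bar> * norm f" if "f \<in> H2_perp" for f
    using C[OF that] by (rule order_trans) (simp add: mult_right_mono)
  then show thesis using that[of "\<bar>C\<bar>"] by simp
qed

lemma shift_add: "shift n (f + g) = shift n f + shift n g"
  by (induction n) (simp_all add: mult_op_add)

lemma shift_cscale: "shift n (c *\<^sub>C f) = c *\<^sub>C shift n f"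
  by (induction n) (simp_all add: mult_op_cscale)

lemma shift_mult_op: "\<phi> \<in> Linf_bGamma \<Longrightarrow> shift n (mult_op \<phi> f) = mult_op \<phi> (shift n f)"
  by (induction n) (simp_all add: mult_op_commute[of pbar \<phi>])

lemma norm_shift [simp]: "norm (shift n f) = norm f"
  by (induction n) simp_all

lemma shift_in: "f \<in> H2_perp \<Longrightarrow> shift n f \<in> H2_perp"
  by (induction n) (simp_all add: H2_perp_pbar)

lemma rel_shift: "f \<in> H2_perp \<Longrightarrow> g \<in> H2_perp \<Longrightarrow> cinner (T (shift n f)) (shift n g) = cinner (T f) g"
  by (induction n) (simp_all add: rel_p shift_in)

text \<open>Since \<open>pbar\<close> preserves \<open>H2_perp\<close>, "eventually" here amounts to
  "for some n". The filter form lets finitely many such conditions be combined at a common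
  n.\<close>

definition eventually_perp :: "L2_bGamma set" where
  "eventually_perp = {f. \<forall>\<^sub>F n in sequentially. shift n f \<in> H2_perp}"

lemma H2_perp_subset_eventually_perp: "H2_perp \<subseteq> eventually_perp"
  by (auto simp: eventually_perp_def shift_in)

lemma csubspace_eventually_perp: "csubspace eventually_perp"
proof -
  have K: "csubspace H2_perp" by (rule csubspace_ortho_compl)
  have "f + g \<in> eventually_perp" if "f \<in> eventually_perp" "g \<in> eventually_perp" for f g
    using that unfolding eventually_perp_def mem_Collect_eq
    by eventually_elim (use K in \<open>simp add: shift_add csubspace_def\<close>)
  moreover have "c *\<^sub>C f \<in> eventually_perp" if "f \<in> eventually_perp" for c f
    using that unfolding eventually_perp_def mem_Collect_eq
    by eventually_elim (use K in \<open>simp add: shift_cscale csubspace_def\<close>)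
  moreover have "0 \<in> eventually_perp" using K H2_perp_subset_eventually_perp by (auto simp: csubspace_def)
  ultimately show ?thesis by (simp add: csubspace_def)
qed

lemma eventually_perp_sbar: "f \<in> eventually_perp \<Longrightarrow> mult_op sbar f \<in> eventually_perp"
  unfolding eventually_perp_def mem_Collect_eq by (erule eventually_mono) (simp add: shift_mult_op H2_perp_sbar)

text \<open>Multiplying by \<open>pbar\<close> moves the sequence of shifts by one index, which
  eventual statements ignore. The forward direction, applied to p f, makes the set stable under
  p.\<close>

lemma eventually_perp_pbar_iff: "mult_op pbar f \<in> eventually_perp \<longleftrightarrow> f \<in> eventually_perp"
  unfolding eventually_perp_def mem_Collect_eq
  by (subst (2) eventually_sequentially_Suc[symmetric]) (simp add: shift_mult_op)

lemma eventually_perp_snd: "f \<in> eventually_perp \<Longrightarrow> mult_op snd f \<in> eventually_perp"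
  using eventually_perp_pbar_iff[of "mult_op snd f"] by simp

text \<open>Here \<open>h\<close> is the value at \<open>f\<close> of the dilation of \<open>T\<close> that will turn out to be multiplication by the
  symbol. By \<open>rel_p\<close> the sequences \<open>cinner (T (shift n f)) (shift n g)\<close> are eventually constant.\<close>

definition represents :: "L2_bGamma \<Rightarrow> L2_bGamma \<Rightarrow> bool" where
  "represents f h \<longleftrightarrow> f \<in> eventually_perp \<and>
    (\<forall>g\<in>eventually_perp. \<forall>\<^sub>F n in sequentially. cinner (T (shift n f)) (shift n g) = cinner h g)"

lemma represents_add:
  assumes "represents f h" "represents f' h'"
  shows "represents (f + f') (h + h')"
proof -
  have "\<forall>\<^sub>F n in sequentially. cinner (T (shift n (f + f'))) (shift n g) = cinner (h + h') g"
    if g: "g \<in> eventually_perp" for g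
  proof -
    have "\<forall>\<^sub>F n in sequentially. shift n f \<in> H2_perp" "\<forall>\<^sub>F n in sequentially. shift n f' \<in> H2_perp"
      "\<forall>\<^sub>F n in sequentially. cinner (T (shift n f)) (shift n g) = cinner h g"
      "\<forall>\<^sub>F n in sequentially. cinner (T (shift n f')) (shift n g) = cinner h' g"
      using assms g by (auto simp: represents_def eventually_perp_def)
    then show ?thesis by eventually_elim (simp add: shift_add T_add cinner_add_left)
  qed
  moreover have "f + f' \<in> eventually_perp" using assms csubspace_eventually_perp by (simp add: represents_def csubspace_def)
  ultimately show ?thesis by (simp add: represents_def)
qed

lemma represents_cscale:
  assumes "represents f h"
  shows "represents (c *\<^sub>C f) (c *\<^sub>C h)"
proof -
  have "\<forall>\<^sub>F n in sequentially. cinner (T (shift n (c *\<^sub>C f))) (shift n g) = cinner (c *\<^sub>C h) g"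
    if g: "g \<in> eventually_perp" for g
  proof -
    have "\<forall>\<^sub>F n in sequentially. shift n f \<in> H2_perp"
      "\<forall>\<^sub>F n in sequentially. cinner (T (shift n f)) (shift n g) = cinner h g"
      using assms g by (auto simp: represents_def eventually_perp_def)
    then show ?thesis by eventually_elim (simp add: shift_cscale T_cscale cinner_scale_left)
  qed
  moreover have "c *\<^sub>C f \<in> eventually_perp" using assms csubspace_eventually_perp by (simp add: represents_def csubspace_def)
  ultimately show ?thesis by (simp add: represents_def)
qed

text \<open>Writing g as \<open>pbar\<close> times p g makes \<open>pbar\<close> a factor of both
  arguments, where it becomes an index shift from n to n + 1. \<open>represents_snd\<close> runs the
  same shift backwards.\<close>

lemma represents_pbar:
  assumes "represents f h"
  shows "represents (mult_op pbar f) (mult_op pbar h)"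
proof -
  have "\<forall>\<^sub>F n in sequentially. cinner (T (shift n (mult_op pbar f))) (shift n g) = cinner (mult_op pbar h) g"
    if g: "g \<in> eventually_perp" for g
  proof -
    have "\<forall>\<^sub>F n in sequentially. cinner (T (shift n f)) (shift n (mult_op snd g)) = cinner h (mult_op snd g)"
      using assms eventually_perp_snd[OF g] by (simp add: represents_def)
    then have "\<forall>\<^sub>F n in sequentially.
        cinner (T (shift (Suc n) f)) (shift (Suc n) (mult_op snd g)) = cinner h (mult_op snd g)"
      by (subst eventually_sequentially_Suc)
    then show ?thesis
      by (rule eventually_mono) (simp add: shift_mult_op cinner_pbar)
  qed
  then show ?thesis using assms by (simp add: represents_def eventually_perp_pbar_iff)
qed

lemma represents_snd:
  assumes "represents f h"
  shows "represents (mult_op snd f) (mult_op snd h)"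
proof -
  have "\<forall>\<^sub>F n in sequentially. cinner (T (shift n (mult_op snd f))) (shift n g) = cinner (mult_op snd h) g"
    if g: "g \<in> eventually_perp" for g
  proof -
    have "\<forall>\<^sub>F n in sequentially. cinner (T (shift n f)) (shift n (mult_op pbar g)) = cinner h (mult_op pbar g)"
      using assms g by (simp add: represents_def eventually_perp_pbar_iff)
    then have "\<forall>\<^sub>F n in sequentially.
        cinner (T (shift (Suc n) (mult_op snd f))) (shift (Suc n) g) = cinner (mult_op snd h) g"
      by (rule eventually_mono) (simp add: shift_mult_op cinner_snd)
    then show ?thesis by (subst (asm) eventually_sequentially_Suc)
  qed
  then show ?thesis using assms by (simp add: represents_def eventually_perp_snd)
qed

text \<open>The first relation enters here. Applied to the n-th shifts, it trades
  \<open>sbar\<close> on f for \<open>pbar\<close> on f and \<open>sbar\<close> on g, a pairing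
  already known from \<open>represents_pbar\<close>; the limits match because s * pbar = sbar on the
  boundary.\<close>

lemma represents_sbar:
  assumes "represents f h"
  shows "represents (mult_op sbar f) (mult_op sbar h)"
proof -
  have "\<forall>\<^sub>F n in sequentially. cinner (T (shift n (mult_op sbar f))) (shift n g) = cinner (mult_op sbar h) g"
    if g: "g \<in> eventually_perp" for g
  proof -
    have "\<forall>\<^sub>F n in sequentially.
        cinner (T (shift n (mult_op pbar f))) (shift n (mult_op sbar g)) = cinner (mult_op pbar h) (mult_op sbar g)"
      using represents_pbar[OF assms] eventually_perp_sbar[OF g] by (simp add: represents_def)
    moreover have "\<forall>\<^sub>F n in sequentially. shift n f \<in> H2_perp" "\<forall>\<^sub>F n in sequentially. shift n g \<in> H2_perp"
      using assms g by (auto simp: represents_def eventually_perp_def)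
    ultimately show ?thesis
    proof eventually_elim
      case (elim n)
      then show ?case
        by (simp add: shift_mult_op rel_s cinner_sbar flip: mult_op_snd_sbar) (simp add: cinner_pbar)
    qed
  qed
  then show ?thesis using assms by (simp add: represents_def eventually_perp_sbar)
qed

lemma represents_fst:
  "represents f h \<Longrightarrow> represents (mult_op fst f) (mult_op fst h)"
  using represents_snd[OF represents_sbar] by (simp add: mult_op_snd_sbar)

lemma represents_polynomial:
  assumes q: "real_polynomial_function q" and fh: "represents f h"
  shows "represents (mult_op (\<lambda>x. complex_of_real (q x)) f) (mult_op (\<lambda>x. complex_of_real (q x)) h)"
proof -
  \<comment> \<open>Quantifying over all pairs f, h makes the set closed under products by applying
    two symbols in succession; membership in \<open>Linf_bGamma\<close> allows the composite to be
    read as one multiplication.\<close>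
  let ?\<A> = "{\<psi> \<in> Linf_bGamma. \<forall>f h. represents f h \<longrightarrow> represents (mult_op \<psi> f) (mult_op \<psi> h)}"
  have "(\<lambda>x. complex_of_real (q x)) \<in> ?\<A>"
  proof (rule real_polynomial_in_star_algebra[OF _ _ _ _ _ _ _ q])
    show "(\<lambda>x. cnj (fst x)) \<in> ?\<A>" "(\<lambda>x. cnj (snd x)) \<in> ?\<A>"
      using represents_sbar represents_pbar by (simp_all add: sbar_eq pbar_eq)
  qed (auto simp: mult_op_const represents_cscale mult_op_sum_symbol represents_add
      represents_fst represents_snd simp flip: mult_op_mult_op)
  then show ?thesis using fh by simp
qed

lemma unshift_shift: "n \<le> m \<Longrightarrow> shift m ((mult_op snd ^^ n) f) = shift (m - n) f"
proof (induction n arbitrary: f)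
  case (Suc n)
  have "shift m ((mult_op snd ^^ n) (mult_op snd f)) = shift (m - n) (mult_op snd f)"
    using Suc by simp
  also have "m - n = Suc (m - Suc n)" using Suc.prems by simp
  also have "shift (Suc (m - Suc n)) (mult_op snd f) = shift (m - Suc n) f"
    by (simp add: shift_mult_op)
  finally show ?case by (simp add: funpow_swap1)
qed simp

lemma cinner_unshift: "cinner ((mult_op snd ^^ n) f) g = cinner f (shift n g)"
  by (induction n arbitrary: g) (simp_all add: cinner_snd shift_mult_op)

text \<open>The vectors \<open>u n\<close> satisfy \<open>u m - u n \<bottom> u n\<close> for \<open>m \<ge> n\<close>, so their norms increase and they form
  a Cauchy sequence.\<close>

lemma represents_exists:
  assumes v: "v \<in> H2_perp"
  obtains w where "represents v w"
proof -
  define u where "u n = (mult_op snd ^^ n) (T (shift n v))" for n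
  have inner_u: "cinner (u m) (u n) = complex_of_real ((norm (T (shift n v)))\<^sup>2)" if "n \<le> m" for m n
  proof -
    have "cinner (u m) (u n) = cinner (T (shift m v)) (shift (m - n) (T (shift n v)))"
      using that by (simp add: u_def cinner_unshift unshift_shift)
    also have "shift m v = shift (m - n) (shift n v)"
      using that by (simp flip: funpow_add[THEN fun_cong, unfolded o_def])
    \<comment> \<open>The second argument T (shift n v) lies in \<open>H2_perp\<close>, so
      \<open>rel_shift\<close> removes all m - n common shifts.\<close>
    also have "cinner (T (shift (m - n) (shift n v))) (shift (m - n) (T (shift n v)))
        = cinner (T (shift n v)) (T (shift n v))"
      by (intro rel_shift shift_in T_in v)
    finally show ?thesis by (simp only: cinner_self)
  qed
  define a where "a n = (norm (T (shift n v)))\<^sup>2" for n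
  have diff: "(norm (u m - u n))\<^sup>2 = a m - a n" if "n \<le> m" for m n
  proof -
    have "cinner (u n) (u m) = complex_of_real (a n)"
      using inner_u[OF that] cinner_commute[of "u n" "u m"] by (simp add: a_def)
    then have "complex_of_real ((norm (u m - u n))\<^sup>2) = complex_of_real (a m - a n)"
      unfolding cinner_self[symmetric] cinner_diff_left cinner_diff_right
      by (simp add: inner_u that a_def)
    then show ?thesis using of_real_eq_iff by blast
  qed
  obtain C where C: "C \<ge> 0" "\<And>f. f \<in> H2_perp \<Longrightarrow> norm (T f) \<le> C * norm f" by (rule T_bound) blast
  have "incseq a"
  proof (rule incseq_SucI)
    show "a n \<le> a (Suc n)" for n
      using diff[of n "Suc n"] zero_le_power2[of "norm (u (Suc n) - u n)"] by simp
  qed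
  moreover have "a n \<le> (C * norm v)\<^sup>2" for n
    unfolding a_def using C(2)[OF shift_in[OF v], of n] by (intro power_mono) auto
  ultimately obtain l where "a \<longlonglongrightarrow> l" using incseq_convergent by blast
  then have a: "Cauchy a" by (rule LIMSEQ_imp_Cauchy)
  have "Cauchy u"
  proof (rule CauchyI)
    fix e :: real assume e: "e > 0"
    then obtain M where M: "\<And>m n. m \<ge> M \<Longrightarrow> n \<ge> M \<Longrightarrow> \<bar>a m - a n\<bar> < e\<^sup>2"
      using CauchyD[OF a, of "e\<^sup>2"] by auto
    have *: "norm (u m - u n) < e" if "n \<ge> M" "m \<ge> n" for m n
    proof -
      have "(norm (u m - u n))\<^sup>2 < e\<^sup>2" using M[of m n] that by (simp add: diff)
      then show ?thesis using e by (simp add: power2_less_imp_less)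
    qed
    have "norm (u m - u n) < e" if "m \<ge> M" "n \<ge> M" for m n
      using *[of n m] *[of m n] that by (cases "n \<le> m") (simp_all add: norm_minus_commute)
    then show "\<exists>M. \<forall>m\<ge>M. \<forall>n\<ge>M. norm (u m - u n) < e" by blast
  qed
  then obtain w where w: "u \<longlonglongrightarrow> w" using Cauchy_convergent convergentD by blast
  have "\<forall>\<^sub>F n in sequentially. cinner (T (shift n v)) (shift n g) = cinner w g" if g: "g \<in> eventually_perp" for g
  proof -
    obtain N where N: "\<And>n. n \<ge> N \<Longrightarrow> shift n g \<in> H2_perp"
      using g by (auto simp: eventually_perp_def eventually_sequentially)
    have const: "cinner (T (shift n v)) (shift n g) = cinner (T (shift N v)) (shift N g)" if "n \<ge> N" for n
    proof -
      have "shift n f = shift (n - N) (shift N f)" for f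
        using that by (simp flip: funpow_add[THEN fun_cong, unfolded o_def])
      then show ?thesis using rel_shift[OF shift_in[OF v] N[OF order_refl], of "n - N" N] by simp
    qed
    have "(\<lambda>n. cinner (u n) g) \<longlonglongrightarrow> cinner w g" by (intro tendsto_cinner w tendsto_const)
    moreover have "(\<lambda>n. cinner (u n) g) \<longlonglongrightarrow> cinner (T (shift N v)) (shift N g)"
      by (rule tendsto_eventually, rule eventually_sequentiallyI[of N])
        (simp only: u_def cinner_unshift, rule const)
    ultimately have "cinner w g = cinner (T (shift N v)) (shift N g)" by (rule LIMSEQ_unique)
    then show ?thesis by (intro eventually_sequentiallyI[of N]) (simp only:, rule const)
  qed
  then have "represents v w" using v H2_perp_subset_eventually_perp by (auto simp: represents_def)
  then show thesis by (rule that)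
qed

text \<open>A single large n suffices: the shifts are isometric, so the constant of T passes to the
  dilation unchanged.\<close>

lemma represents_bound:
  assumes C: "C \<ge> 0" "\<And>f. f \<in> H2_perp \<Longrightarrow> norm (T f) \<le> C * norm f"
    and f: "represents f h" and g: "g \<in> eventually_perp"
  shows "cmod (cinner h g) \<le> C * norm f * norm g"
proof -
  have "\<forall>\<^sub>F n in sequentially. shift n f \<in> H2_perp \<and> cinner (T (shift n f)) (shift n g) = cinner h g"
    using f g by (auto simp: represents_def eventually_perp_def intro: eventually_conj)
  then obtain n where n: "shift n f \<in> H2_perp" "cinner (T (shift n f)) (shift n g) = cinner h g"
    by (auto simp: eventually_sequentially)
  have "cmod (cinner h g) \<le> norm (T (shift n f)) * norm (shift n g)"
    unfolding n(2)[symmetric] by (rule cinner_Cauchy_Schwarz)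
  also have "\<dots> \<le> C * norm f * norm g"
    using C(2)[OF n(1)] by (simp add: mult_right_mono)
  finally show ?thesis .
qed

theorem dual_toeplitz_symbol: "\<exists>\<phi>\<in>Linf_bGamma. \<forall>f\<in>H2_perp. T f = dual_toeplitz \<phi> f"
proof -
  obtain C where C: "C \<ge> 0" "\<And>f. f \<in> H2_perp \<Longrightarrow> norm (T f) \<le> C * norm f" by (rule T_bound) blast
  obtain w where "represents (mult_op pbar L2_one) w"
    using represents_exists[OF pbar_in_H2_perp] by blast
  \<comment> \<open>The dilation commutes with p, so its value at 1 = p * pbar is p times its value
    at \<open>pbar\<close>, which lies in \<open>H2_perp\<close>.\<close>
  from represents_snd[OF this] obtain h where h: "represents L2_one h" by auto
  obtain \<phi> where \<phi>: "sq_int \<phi>" "h = abs_L2_bGamma \<phi>" by (cases h rule: L2_bGamma_cases)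
  have poly_dom: "mult_op (\<lambda>x. complex_of_real (q x)) L2_one \<in> eventually_perp" if "real_polynomial_function q" for q
    using represents_polynomial[OF that h] by (simp add: represents_def)
  have "closure eventually_perp = UNIV"
  proof (rule UNIV_eq_I[symmetric])
    fix f
    have "\<exists>g\<in>eventually_perp. dist g f < e" if "e > 0" for e
      using csubspace_polynomials_dense[OF csubspace_eventually_perp that poly_dom, of f]
      by (metis dist_commute dist_norm)
    then show "f \<in> closure eventually_perp" by (simp add: closure_approachable)
  qed
  note norm_le = norm_le_if_cinner_le_dense[OF this]
  \<comment> \<open>For each polynomial q the product q h represents the value at q, so the dilation
    bound gives |q phi| \<le> C |q| in norm, with the constant C of T itself.\<close>
  have bdd: "AE x in nu. cmod (\<phi> x) \<le> C"
    using represents_bound[OF C represents_polynomial[OF _ h]] C(1)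
    by (intro AE_bounded_if_polynomials_bounded \<phi>(1) norm_le) (auto simp: \<phi>(2))
  then have L: "\<phi> \<in> Linf_bGamma" using \<phi>(1) by (auto simp: Linf_bGamma_def sq_int_def)
  define S where "S = {f. represents f (mult_op \<phi> f)}"
  have "0 \<in> S"
    using represents_cscale[OF h, of 0] mult_op_cscale[of \<phi> 0 0] by (simp add: S_def cscale_zero_left)
  then have S: "csubspace S"
    by (simp add: csubspace_def S_def mult_op_add mult_op_cscale represents_add represents_cscale)
  have poly_S: "mult_op (\<lambda>x. complex_of_real (q x)) L2_one \<in> S" if q: "real_polynomial_function q" for q
    using represents_polynomial[OF q h] L polynomial_in_Linf[OF q]
    by (simp add: S_def \<phi>(2) mult_op_commute[of \<phi>] mult_op_one[OF L])
  have "T f = dual_toeplitz \<phi> f" if f: "f \<in> H2_perp" for f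
  proof (rule H2_perp_eqI)
    obtain w where w: "represents f w" using represents_exists[OF f] by blast
    \<comment> \<open>With g in S close to f, one C e bounds w - phi g, the value represented at f -
      g, and the other bounds phi (f - g).\<close>
    have le: "norm (w - mult_op \<phi> f) \<le> 2 * C * e" if "e > 0" for e
    proof -
      obtain g where g: "g \<in> S" "norm (f - g) < e"
        using poly_S by (rule csubspace_polynomials_dense[OF S \<open>e > 0\<close>])
      have "represents (f - g) (w - mult_op \<phi> g)"
        using represents_add[OF w represents_cscale[of g "mult_op \<phi> g" "- 1"]] g(1)
        by (simp add: S_def flip: uminus_eq_cscale)
      from represents_bound[OF C this] have "norm (w - mult_op \<phi> g) \<le> C * norm (f - g)"
        using C(1) by (intro norm_le) auto
      moreover have "norm (mult_op \<phi> (f - g)) \<le> C * norm (f - g)"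
        using norm_mult_op_le[OF _ bdd, of "f - g"] L C(1) by (simp add: Linf_bGamma_def)
      moreover have "norm (w - mult_op \<phi> f) \<le> norm (w - mult_op \<phi> g) + norm (mult_op \<phi> (f - g))"
        using norm_triangle_ineq4[of "w - mult_op \<phi> g" "mult_op \<phi> (f - g)"] by (simp add: mult_op_diff)
      moreover have "C * norm (f - g) \<le> C * e"
        using g(2) C(1) by (intro mult_left_mono) auto
      ultimately show ?thesis by linarith
    qed
    have "norm (w - mult_op \<phi> f) \<le> 0 + e" if "e > 0" for e
    proof -
      \<comment> \<open>The extra 1 keeps the denominator positive when C = 0.\<close>
      have "2 * C * (e / (2 * C + 1)) \<le> e" using that C(1) by (simp add: field_simps)
      then show ?thesis using le[of "e / (2 * C + 1)"] that C(1) by simp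
    qed
    then have wf: "w = mult_op \<phi> f" using field_le_epsilon[of "norm (w - mult_op \<phi> f)" 0] by simp
    fix g assume g: "g \<in> H2_perp"
    then have "\<forall>\<^sub>F n in sequentially. cinner (T (shift n f)) (shift n g) = cinner w g"
      using w H2_perp_subset_eventually_perp by (auto simp: represents_def)
    \<comment> \<open>For f and g in \<open>H2_perp\<close> the pairing is constant from n = 0 on,
      so the eventual equality already holds for T f.\<close>
    then have "cinner (T f) g = cinner w g"
      by (simp add: rel_shift f g)
    then show "cinner (T f) g = cinner (dual_toeplitz \<phi> f) g"
      by (simp add: wf cinner_dual_toeplitz g)
  qed (simp_all add: T_in f)
  then show ?thesis using L by blast
qed

end

theorem theorem6:
  fixes T :: "L2_bGamma \<Rightarrow> L2_bGamma"
  assumes "bounded_op_on H2_perp T"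
  shows "(\<exists>\<phi>\<in>Linf_bGamma. \<forall>f\<in>H2_perp. T f = dual_toeplitz \<phi> f) \<longleftrightarrow>
    (\<forall>f\<in>H2_perp. adjoint_on H2_perp (dual_toeplitz sbar) (T (dual_toeplitz pbar f))
        = T (dual_toeplitz sbar f)) \<and>
    (\<forall>f\<in>H2_perp. adjoint_on H2_perp (dual_toeplitz pbar) (T (dual_toeplitz pbar f)) = T f)"
proof -
  have T: "T f \<in> H2_perp" if "f \<in> H2_perp" for f
    using assms that by (simp add: bounded_op_on_def)
  \<comment> \<open>Weak form of the relations: both sides lie in \<open>H2_perp\<close>, so
    equality can be tested there. The adjoints are compressions of s and p, and moving these across
    the pairing puts \<open>sbar\<close> and \<open>pbar\<close> on g.\<close>
  have rels: "(\<forall>f\<in>H2_perp. adjoint_on H2_perp (dual_toeplitz sbar) (T (dual_toeplitz pbar f))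
        = T (dual_toeplitz sbar f)) \<longleftrightarrow>
      (\<forall>f\<in>H2_perp. \<forall>g\<in>H2_perp. cinner (T (mult_op pbar f)) (mult_op sbar g) = cinner (T (mult_op sbar f)) g)"
    "(\<forall>f\<in>H2_perp. adjoint_on H2_perp (dual_toeplitz pbar) (T (dual_toeplitz pbar f)) = T f) \<longleftrightarrow>
      (\<forall>f\<in>H2_perp. \<forall>g\<in>H2_perp. cinner (T (mult_op pbar f)) (mult_op pbar g) = cinner (T f) g)"
    by (simp_all add: H2_perp_eq_iff dual_toeplitz_pbar dual_toeplitz_sbar H2_perp_pbar H2_perp_sbar T
        adjoint_sbar adjoint_pbar cinner_dual_toeplitz cinner_fst cinner_snd)
  show ?thesis
    unfolding rels
  proof (intro iffI conjI ballI)
    assume "\<exists>\<phi>\<in>Linf_bGamma. \<forall>f\<in>H2_perp. T f = dual_toeplitz \<phi> f"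
    then obtain \<phi> where \<phi>: "\<phi> \<in> Linf_bGamma" and T: "\<And>f. f \<in> H2_perp \<Longrightarrow> T f = dual_toeplitz \<phi> f"
      by blast
    fix f g assume fg: "f \<in> H2_perp" "g \<in> H2_perp"
    show "cinner (T (mult_op pbar f)) (mult_op sbar g) = cinner (T (mult_op sbar f)) g"
      "cinner (T (mult_op pbar f)) (mult_op pbar g) = cinner (T f) g"
      \<comment> \<open>Moved back to the left, s and p meet the factor \<open>pbar\<close>, and on
        the boundary s * pbar = sbar and p * pbar = 1.\<close>
      using fg \<phi> by (simp_all add: T H2_perp_pbar H2_perp_sbar cinner_dual_toeplitz)
        (simp_all add: mult_op_fst_pbar mult_op_commute[of _ \<phi>] flip: cinner_fst cinner_snd)
  next
    assume rel: "(\<forall>f\<in>H2_perp. \<forall>g\<in>H2_perp. cinner (T (mult_op pbar f)) (mult_op sbar g) = cinner (T (mult_op sbar f)) g) \<and>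
      (\<forall>f\<in>H2_perp. \<forall>g\<in>H2_perp. cinner (T (mult_op pbar f)) (mult_op pbar g) = cinner (T f) g)"
    interpret brown_halmos T
      using assms rel by unfold_locales auto
    show "\<exists>\<phi>\<in>Linf_bGamma. \<forall>f\<in>H2_perp. T f = dual_toeplitz \<phi> f"
      by (rule dual_toeplitz_symbol)
  qed
qed

end
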